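(* Let $G_\bullet$ be a prefiltration of finite length and let $F\leq\mathrm{VIP}(G_\bullet)$ be an FVIP group. Suppose that $G_0$ acts on a Hilbert space $H$ by unitary operators and that for each $g=(g_\alpha)_\alpha\in F$ the weak limit $P_g=\operatorname{w-IP-lim}_{\alpha\in\mathcal F}g_\alpha$ exists. Then \begin{enumerate} \item each $P_g$, $g\in F$, is an orthogonal projection, and \item these projections commute pairwise. \end{enumerate}
   Context: $\mathbb N=\{0,1,\dots\}$; $\mathcal F_\emptyset$ is the set of finite subsets of $\mathbb N$, $\mathcal F=\mathcal F_\emptyset\setminus\{\emptyset\}$; $\alpha<\beta$ means $\max\alpha<\min\beta$. Arguments of maps on $\mathcal F$ are written as subscripts, $g_\alpha=g(\alpha)$. A prefiltration $G_\bullet$ is a nested sequence of groups $G_0\ge G_1\ge\dots$ with $[G_i,G_j]\subset G_{i+j}$ for all $i,j\in\mathbb N$. It has length $d\in\mathbb N$ if $G_{d+1}$ is trivial, length $-\infty$ if $G_0$ is trivial. $G_{\bullet+1}$ is the prefiltration $(G_{\bullet+1})_i=G_{i+1}$, of length $d-1$ ($-\infty$ if $d=0$). A map $g:\mathcal F_\emptyset\to G_0$ is $G_\bullet$-polynomial if either $d=-\infty$ (and $g$ is identically the identity) or for every $\alpha\in\mathcal F_\emptyset$ there is a $G_{\bullet+1}$-polynomial map $D_\alpha g$ with $D_\alpha g(\beta)=g(\beta)^{-1}g(\alpha\cup\beta)$ for all $\beta\in\mathcal F_\emptyset$ disjoint from $\alpha$. $\mathrm{VIP}(G_\bullet)$ is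 the group (under pointwise operations) of $G_\bullet$-polynomial maps with $g(\emptyset)=1$; its members are regarded as functions on $\mathcal F$. The symmetric derivative is $\tilde D_\alpha g(\beta)=g(\beta)^{-1}g(\alpha\cup\beta)g(\alpha)^{-1}$ for $\beta\cap\alpha=\emptyset$. A VIP group is a subgroup $F\le\mathrm{VIP}(G_\bullet)$ closed under conjugation by constant ($G_0$-valued) functions and such that for every $g\in F$, $\alpha\in\mathcal F$ the symmetric derivative $\tilde D_\alpha g$ lies in $F\cap\mathrm{VIP}(G_{\bullet+1})$ (i.e. agrees on its domain with an element of this group). An FVIP group is a finitely generated VIP group. $\operatorname{w-IP-lim}_{\alpha\in\mathcal F}g_\alpha=P$ means that for every $f\in H$ and every weak neighbourhood $U$ of $Pf$ there is $\alpha_0\in\mathcal F$ with $g_\alpha f\in U$ for all $\alpha>\alpha_0$. *)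

theory Defs
  imports
    "HOL-Analysis.Analysis"
    "HOL-Algebra.Algebra"
    "HOL-Library.FSet"
begin

section \<open>Finite subsets of the natural numbers\<close>

text \<open>The type \<open>nat fset\<close> plays the role of the family of all finite subsets of the naturals,
  the empty one included; the restriction to nonempty sets is always written explicitly.
  The following relation is only meaningful, and only used, for nonempty sets.\<close>

definition fin_less :: "nat fset \<Rightarrow> nat fset \<Rightarrow> bool"  (infix \<open>\<lless>\<close> 50)
  where "\<alpha> \<lless> \<beta> \<longleftrightarrow> fMax \<alpha> < fMin \<beta>"


section \<open>Prefiltrations\<close>

definition commutator_subgroup :: "('g, 'm) monoid_scheme \<Rightarrow> 'g set \<Rightarrow> 'g set \<Rightarrow> 'g set"
  where "commutator_subgroup A H K =
    generate A {inv\<^bsub>A\<^esub> h \<otimes>\<^bsub>A\<^esub> inv\<^bsub>A\<^esub> k \<otimes>\<^bsub>A\<^esub> h \<otimes>\<^bsub>A\<^esub> k | h k. h \<in> H \<and> k \<in> K}"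

text \<open>The groups of a prefiltration are subgroups of an ambient group \<open>A\<close>, which need not be
  \<open>G 0\<close>; this way the shifted prefiltration lives in the same ambient group.\<close>

definition prefiltration :: "('g, 'm) monoid_scheme \<Rightarrow> (nat \<Rightarrow> 'g set) \<Rightarrow> bool"
  where "prefiltration A G \<longleftrightarrow>
    group A \<and>
    (\<forall>i. subgroup (G i) A) \<and>
    (\<forall>i. G (Suc i) \<subseteq> G i) \<and>
    (\<forall>i j. commutator_subgroup A (G i) (G j) \<subseteq> G (i + j))"

definition shift :: "(nat \<Rightarrow> 'g set) \<Rightarrow> nat \<Rightarrow> 'g set"
  where "shift G = (\<lambda>i. G (i + 1))"

text \<open>The first disjunct is length minus infinity, the second one is length \<open>d\<close>.\<close>

definition finite_length :: "('g, 'm) monoid_scheme \<Rightarrow> (nat \<Rightarrow> 'g set) \<Rightarrow> bool"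
  where "finite_length A G \<longleftrightarrow> G 0 = {\<one>\<^bsub>A\<^esub>} \<or> (\<exists>d. G (d + 1) = {\<one>\<^bsub>A\<^esub>})"


section \<open>Polynomial maps and VIP groups\<close>

text \<open>Recursion on the length of the prefiltration, rendered as an inductive predicate: the
  base case is length minus infinity, and for a prefiltration of finite length the shift in
  the second rule reaches it after finitely many steps. If \<open>G 0\<close> is trivial, both rules
  only admit the identity map.\<close>

inductive polynomial_map ::
    "('g, 'm) monoid_scheme \<Rightarrow> (nat \<Rightarrow> 'g set) \<Rightarrow> (nat fset \<Rightarrow> 'g) \<Rightarrow> bool"
  for A :: "('g, 'm) monoid_scheme" where
  trivial: "G 0 = {\<one>\<^bsub>A\<^esub>} \<Longrightarrow> (\<forall>\<beta>. g \<beta> = \<one>\<^bsub>A\<^esub>) \<Longrightarrow> polynomial_map A G g"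
| derivative:
    "(\<forall>\<beta>. g \<beta> \<in> G 0) \<Longrightarrow>
     (\<forall>\<alpha>. \<exists>Dg. polynomial_map A (shift G) Dg \<and>
        (\<forall>\<beta>. \<alpha> |\<inter>| \<beta> = {||} \<longrightarrow> Dg \<beta> = inv\<^bsub>A\<^esub> (g \<beta>) \<otimes>\<^bsub>A\<^esub> g (\<alpha> |\<union>| \<beta>))) \<Longrightarrow>
     polynomial_map A G g"

text \<open>Pointwise operations. A function on the nonempty finite sets is represented by its
  unique extension with value 1 at the empty set.\<close>

definition VIP :: "('g, 'm) monoid_scheme \<Rightarrow> (nat \<Rightarrow> 'g set) \<Rightarrow> (nat fset \<Rightarrow> 'g) monoid"
  where "VIP A G = (product_group UNIV (\<lambda>_. A))
    \<lparr>carrier := {g. polynomial_map A G g \<and> g {||} = \<one>\<^bsub>A\<^esub>}\<rparr>"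

definition VIP_group ::
    "('g, 'm) monoid_scheme \<Rightarrow> (nat \<Rightarrow> 'g set) \<Rightarrow> (nat fset \<Rightarrow> 'g) set \<Rightarrow> bool"
  where "VIP_group A G F \<longleftrightarrow>
    subgroup F (VIP A G) \<and>
    (\<forall>g\<in>F. \<forall>c\<in>G 0. (\<lambda>\<alpha>. inv\<^bsub>A\<^esub> c \<otimes>\<^bsub>A\<^esub> g \<alpha> \<otimes>\<^bsub>A\<^esub> c) \<in> F) \<and>
    (\<forall>g\<in>F. \<forall>\<alpha>. \<alpha> \<noteq> {||} \<longrightarrow>
      (\<exists>h \<in> F \<inter> carrier (VIP A (shift G)).
        \<forall>\<beta>. \<beta> |\<inter>| \<alpha> = {||} \<longrightarrow>
          h \<beta> = inv\<^bsub>A\<^esub> (g \<beta>) \<otimes>\<^bsub>A\<^esub> g (\<alpha> |\<union>| \<beta>) \<otimes>\<^bsub>A\<^esub> inv\<^bsub>A\<^esub> (g \<alpha>)))"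

definition FVIP_group ::
    "('g, 'm) monoid_scheme \<Rightarrow> (nat \<Rightarrow> 'g set) \<Rightarrow> (nat fset \<Rightarrow> 'g) set \<Rightarrow> bool"
  where "FVIP_group A G F \<longleftrightarrow>
    VIP_group A G F \<and> (\<exists>S. finite S \<and> S \<subseteq> F \<and> F = generate (VIP A G) S)"


section \<open>Complex Hilbert spaces\<close>

text \<open>HOL-Analysis only has real inner products. The inner product below is linear in its
  first argument.\<close>

class complex_hilbert = banach +
  fixes scaleC :: "complex \<Rightarrow> 'a \<Rightarrow> 'a"  (infixr \<open>*\<^sub>C\<close> 75)
    and cinner :: "'a \<Rightarrow> 'a \<Rightarrow> complex"
  assumes scaleC_add_right: "c *\<^sub>C (x + y) = c *\<^sub>C x + c *\<^sub>C y"
    and scaleC_add_left: "(c + d) *\<^sub>C x = c *\<^sub>C x + d *\<^sub>C x"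
    and scaleC_scaleC: "c *\<^sub>C (d *\<^sub>C x) = (c * d) *\<^sub>C x"
    and scaleC_of_real: "complex_of_real r *\<^sub>C x = r *\<^sub>R x"
    and cinner_commute: "cinner x y = cnj (cinner y x)"
    and cinner_add_left: "cinner (x + y) z = cinner x z + cinner y z"
    and cinner_scaleC_left: "cinner (c *\<^sub>C x) y = c * cinner x y"
    and cinner_self: "cinner x x = complex_of_real ((norm x)\<^sup>2)"

instantiation complex :: complex_hilbert
begin
definition scaleC_complex_def: "scaleC c x = c * (x :: complex)"
definition cinner_complex_def: "cinner x y = x * cnj (y :: complex)"
instance
proof
  fix x y z c d :: complex and r :: real
  show "c *\<^sub>C (x + y) = c *\<^sub>C x + c *\<^sub>C y" "(c + d) *\<^sub>C x = c *\<^sub>C x + d *\<^sub>C x"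
    by (simp_all add: scaleC_complex_def distrib_left distrib_right)
  show "c *\<^sub>C (d *\<^sub>C x) = (c * d) *\<^sub>C x"
    by (simp add: scaleC_complex_def mult.assoc)
  show "complex_of_real r *\<^sub>C x = r *\<^sub>R x"
    by (simp add: scaleC_complex_def scaleR_conv_of_real)
  show "cinner x y = cnj (cinner y x)"
    by (simp add: cinner_complex_def mult.commute)
  show "cinner (x + y) z = cinner x z + cinner y z"
    by (simp add: cinner_complex_def distrib_right)
  show "cinner (c *\<^sub>C x) y = c * cinner x y"
    by (simp add: cinner_complex_def scaleC_complex_def mult.assoc)
  show "cinner x x = complex_of_real ((norm x)\<^sup>2)"
    unfolding cinner_complex_def by (rule complex_norm_square [symmetric])
qed
end

definition clinear_op :: "('h::complex_hilbert \<Rightarrow> 'h) \<Rightarrow> bool"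
  where "clinear_op T \<longleftrightarrow>
    (\<forall>x y. T (x + y) = T x + T y) \<and> (\<forall>c x. T (c *\<^sub>C x) = c *\<^sub>C T x)"

definition unitary_op :: "('h::complex_hilbert \<Rightarrow> 'h) \<Rightarrow> bool"
  where "unitary_op T \<longleftrightarrow>
    clinear_op T \<and> surj T \<and> (\<forall>x y. cinner (T x) (T y) = cinner x y)"

definition orthogonal_projection :: "('h::complex_hilbert \<Rightarrow> 'h) \<Rightarrow> bool"
  where "orthogonal_projection T \<longleftrightarrow>
    clinear_op T \<and> bounded_linear T \<and> T \<circ> T = T \<and>
    (\<forall>x y. cinner (T x) y = cinner x (T y))"

text \<open>The continuous complex linear functionals; \<open>bounded_linear\<close> is real linearity
  together with boundedness.\<close>

definition cfunctionals :: "('h::complex_hilbert \<Rightarrow> complex) set"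
  where "cfunctionals = {\<phi>. bounded_linear \<phi> \<and> (\<forall>c x. \<phi> (c *\<^sub>C x) = c * \<phi> x)}"

definition weak_top :: "'h::complex_hilbert topology"
  where "weak_top = topology_generated_by {\<phi> -` V | \<phi> V. \<phi> \<in> cfunctionals \<and> open V}"

definition w_IP_lim :: "(nat fset \<Rightarrow> 'h \<Rightarrow> 'h) \<Rightarrow> ('h::complex_hilbert \<Rightarrow> 'h) \<Rightarrow> bool"
  where "w_IP_lim T P \<longleftrightarrow>
    (\<forall>f U. openin weak_top U \<and> P f \<in> U \<longrightarrow>
      (\<exists>\<alpha>\<^sub>0. \<alpha>\<^sub>0 \<noteq> {||} \<and> (\<forall>\<alpha>. \<alpha> \<noteq> {||} \<and> \<alpha>\<^sub>0 \<lless> \<alpha> \<longrightarrow> T \<alpha> f \<in> U)))"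

definition unitary_action ::
    "('g, 'm) monoid_scheme \<Rightarrow> 'g set \<Rightarrow> ('g \<Rightarrow> 'h::complex_hilbert \<Rightarrow> 'h) \<Rightarrow> bool"
  where "unitary_action A K \<pi> \<longleftrightarrow>
    group_action (A\<lparr>carrier := K\<rparr>) UNIV \<pi> \<and> (\<forall>a\<in>K. unitary_op (\<pi> a))"

end

theory Submission
  imports Defs
begin

text \<open>The symmetric derivative rewrites \<open>g (\<alpha> \<union> \<beta>)\<close> as \<open>g \<beta> \<cdot> g \<alpha> \<cdot> k\<^sub>\<alpha> \<beta>\<close>, where \<open>k\<^sub>\<alpha>\<close> is
  again a member of the group, but of lower degree. So the proof descends through a series
  \<open>F = F\<^sub>0, F\<^sub>1, \<dots>\<close> of subgroups of \<open>F\<close> (\<open>level\<close>) whose \<open>i\<close>-th term consists of the members that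
  behave like polynomials of the \<open>i\<close> times shifted prefiltration, and proves the theorem for \<open>F\<^sub>i\<close>
  from the theorem for \<open>F\<^sub>i\<^sub>+\<^sub>1\<close>. In the last term every map is eventually the identity.

  Call a vector \<open>v\<close> homogeneous if every \<open>P\<^sub>k\<close> with \<open>k \<in> F\<^sub>i\<^sub>+\<^sub>1\<close> fixes or kills it. A vector that is
  orthogonal to all homogeneous ones is zero (\<open>orthogonal_homogeneous_eq_0\<close>): among the nonzero
  such vectors choose one whose stabiliser in \<open>F\<^sub>i\<^sub>+\<^sub>1\<close> is maximal; if some \<open>P\<^sub>k\<close> does not kill it,
  its image under \<open>P\<^sub>k\<close> has a stabiliser that contains the old one and \<open>k\<close>, so \<open>k\<close> was there
  already, and the vector is itself homogeneous. The maximal choice is possible because \<open>F\<close> takes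
  values in the nilpotent group \<open>G\<^sub>1\<close> and is finitely generated, so that all its subgroups are
  finitely generated. As the adjoint of \<open>P\<^sub>g\<close> is the limit for \<open>g\<inverse>\<close>, an operator identity between
  products of limits therefore has to be checked on homogeneous vectors only.

  Let \<open>g \<in> F\<^sub>i\<close> and let \<open>v\<close> be homogeneous. If the limit for \<open>k\<^sub>\<alpha>\<close> fixes \<open>v\<close> for arbitrarily late \<open>\<alpha>\<close>, then
  letting first \<open>\<beta>\<close> and then \<open>\<alpha>\<close> tend to infinity in \<open>g (\<alpha> \<union> \<beta>) v\<close> gives \<open>P\<^sub>g v = P\<^sub>g P\<^sub>g v\<close>. Otherwise
  it kills \<open>v\<close> for all late \<open>\<alpha>\<close>, the correlations of \<open>g (\<alpha> \<union> \<beta>) v\<close> and \<open>g \<beta> v\<close> vanish in the limit,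
  and a van der Corput argument gives \<open>P\<^sub>g v = 0\<close>. So the contraction \<open>P\<^sub>g\<close> is idempotent, and hence
  an orthogonal projection.

  For commutativity it suffices that the range of \<open>P\<^sub>h\<close> is invariant under \<open>P\<^sub>g\<close>. Conjugating by the
  constant \<open>g \<alpha>\<close> turns \<open>P\<^sub>h (g \<alpha> w)\<close> into \<open>g \<alpha> (P\<^sub>h\<^sub>' w)\<close>, where \<open>h'\<close> is \<open>h\<close> times a member of
  \<open>F\<^sub>i\<^sub>+\<^sub>1\<close>. For \<open>w = P\<^sub>h v\<close> with homogeneous \<open>v\<close> this is \<open>g \<alpha> w\<close> or zero. Letting \<open>\<alpha>\<close> tend to infinity,
  either \<open>P\<^sub>h P\<^sub>g w = P\<^sub>g w\<close>, or \<open>P\<^sub>h P\<^sub>g w = 0\<close>, in which case \<open>\<parallel>P\<^sub>g w\<parallel>\<^sup>2 = \<langle>P\<^sub>h P\<^sub>g w, w\<rangle> = 0\<close>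
  (\<open>limit_in_range\<close>).

  That the \<open>F\<^sub>i\<close> are groups, and that commutators with constants from \<open>G\<^sub>1\<close> lead from \<open>F\<^sub>i\<close> to \<open>F\<^sub>i\<^sub>+\<^sub>1\<close>,
  rests on Leibman's theorem on polynomial maps (\<open>truncated_polynomial_group\<close>).\<close>

text \<open>Exact sequences share this arrow with limits.\<close>

no_notation exact_seq_arrow
  (\<open>(\<open>indent=3 notation=\<open>mixfix exact_seq\<close>\<close>_ / \<longlongrightarrow>\<index> _)\<close> [1000, 60])

section \<open>Group commutators\<close>

definition comm :: "('g, 'm) monoid_scheme \<Rightarrow> 'g \<Rightarrow> 'g \<Rightarrow> 'g"
  where "comm A x y = inv\<^bsub>A\<^esub> x \<otimes>\<^bsub>A\<^esub> inv\<^bsub>A\<^esub> y \<otimes>\<^bsub>A\<^esub> x \<otimes>\<^bsub>A\<^esub> y"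

context group
begin

lemma inv_mult_cancel [simp]:
  "x \<in> carrier G \<Longrightarrow> y \<in> carrier G \<Longrightarrow> inv x \<otimes> (x \<otimes> y) = y"
  "x \<in> carrier G \<Longrightarrow> y \<in> carrier G \<Longrightarrow> x \<otimes> (inv x \<otimes> y) = y"
  by (simp_all flip: m_assoc)

lemma comm_closed [simp]: "x \<in> carrier G \<Longrightarrow> y \<in> carrier G \<Longrightarrow> comm G x y \<in> carrier G"
  by (simp add: comm_def)

lemma conj_eq_mult_comm:
  "x \<in> carrier G \<Longrightarrow> y \<in> carrier G \<Longrightarrow> inv y \<otimes> x \<otimes> y = x \<otimes> comm G x y"
  by (simp add: comm_def m_assoc)

text \<open>This is the derivative of the pointwise commutator of two maps, written in terms of the
  derivatives \<open>a\<close> and \<open>b\<close> of these maps. Every factor on the right contains \<open>a\<close> or \<open>b\<close>, which places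
  it at least one step deeper in the filtration than \<open>c\<close>.\<close>

lemma comm_mult_mult:
  assumes "g \<in> carrier G" "h \<in> carrier G" "a \<in> carrier G" "b \<in> carrier G"
  defines "c \<equiv> comm G g h" and "y \<equiv> comm G (g \<otimes> a) b"
  shows "inv c \<otimes> comm G (g \<otimes> a) (h \<otimes> b) =
    y \<otimes> comm G y c \<otimes> comm G c a \<otimes> comm G a h \<otimes> comm G (comm G (g \<otimes> a) h) b"
  using assms(1-4) unfolding c_def y_def
  by (simp add: comm_def m_assoc inv_mult_group)

lemma comm_mult_right:
  assumes "c \<in> carrier G" "x \<in> carrier G" "y \<in> carrier G"
  shows "comm G c (x \<otimes> y) = comm G c y \<otimes> (inv y \<otimes> comm G c x \<otimes> y)"
  using assms by (simp add: comm_def m_assoc inv_mult_group)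

lemma comm_inv_right:
  assumes "c \<in> carrier G" "x \<in> carrier G"
  shows "comm G c (inv x) = x \<otimes> inv (comm G c x) \<otimes> inv x"
  using assms by (simp add: comm_def m_assoc inv_mult_group)

end

section \<open>Subgroups of finitely generated nilpotent groups\<close>

lemma int_subgroup_principal:
  fixes J :: "int set"
  assumes "J \<noteq> {}" and diff: "\<And>k l. k \<in> J \<Longrightarrow> l \<in> J \<Longrightarrow> k - l \<in> J"
  shows "\<exists>d\<in>J. \<forall>k\<in>J. d dvd k"
proof -
  have zero: "0 \<in> J" using assms by fastforce
  have neg: "- k \<in> J" if "k \<in> J" for k using diff[OF zero that] by simp
  have add: "k + l \<in> J" if "k \<in> J" "l \<in> J" for k l using diff[OF that(1) neg[OF that(2)]] by simp
  show ?thesis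
  proof (cases "J = {0}")
    case True
    then show ?thesis by auto
  next
    case False
    then obtain k where "k \<in> J" "k \<noteq> 0" using zero by blast
    then have ex: "\<exists>n. n > 0 \<and> int n \<in> J"
      using neg[of k] by (intro exI[of _ "nat \<bar>k\<bar>"]) (auto simp: abs_if)
    define d where "d = (LEAST n. n > 0 \<and> int n \<in> J)"
    have d: "d > 0" "int d \<in> J" using LeastI_ex[OF ex] unfolding d_def by auto
    have nat_mult: "int d * int n \<in> J" for n
      by (induction n) (auto simp: zero algebra_simps intro: add d(2))
    have mult: "int d * m \<in> J" for m
      using nat_mult neg by (cases m rule: int_cases2) fastforce+
    \<comment> \<open>division with remainder stays inside \<open>J\<close>\<close>
    have "int d dvd k" if "k \<in> J" for k
    proof -
      have "k mod int d \<in> J"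
        using diff[OF that mult[of "k div int d"]] by (simp add: minus_mult_div_eq_mod)
      moreover have "0 \<le> k mod int d" "k mod int d < int d" using d(1) by auto
      ultimately have "k mod int d = 0"
        using not_less_Least[of "nat (k mod int d)" "\<lambda>n. n > 0 \<and> int n \<in> J"]
        unfolding d_def[symmetric] by auto
      then show ?thesis by auto
    qed
    then show ?thesis using d(2) by blast
  qed
qed

context group
begin

lemma int_pow_commutes:
  assumes "x \<in> carrier G" "y \<in> carrier G" "x \<otimes> y = y \<otimes> x"
  shows "x \<otimes> y [^] (k::int) = y [^] k \<otimes> x"
proof (cases k rule: int_cases2)
  case (nonneg n)
  then show ?thesis
    using group_commutes_pow[OF assms(3)[symmetric], of n] assms by (simp add: int_pow_int)
next
  case (nonpos n)
  define z where "z = y [^] n"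
  have z: "z \<in> carrier G" "z \<otimes> x = x \<otimes> z"
    using group_commutes_pow[OF assms(3)[symmetric], of n] assms by (auto simp: z_def)
  have "x \<otimes> inv z = inv z \<otimes> (z \<otimes> x) \<otimes> inv z"
    using z(1) assms by (simp add: m_assoc)
  also have "\<dots> = inv z \<otimes> x"
    unfolding z(2) using z(1) assms by (simp add: m_assoc)
  finally show ?thesis
    using nonpos assms by (simp add: int_pow_neg_int z_def)
qed

definition subgroups_finitely_generated :: "'a set \<Rightarrow> bool"
  where "subgroups_finitely_generated N \<longleftrightarrow>
    (\<forall>H. subgroup H G \<and> H \<subseteq> N \<longrightarrow> (\<exists>T. finite T \<and> T \<subseteq> H \<and> H = generate G T))"

text \<open>A central extension by a cyclic group. In the quotient \<open>Q\<close> by \<open>N\<close> the image of \<open>c\<close> is central, so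
  its powers form a normal subgroup, and \<open>N'\<close> is the preimage of this subgroup. A subgroup \<open>H\<close> of
  \<open>N'\<close> is generated by generators of \<open>H \<inter> N\<close> and one element of \<open>H\<close> whose image is a
  power of the image of \<open>c\<close> with exponent dividing all others; it exists because the exponents form
  a subgroup of the integers.\<close>

lemma subgroups_finitely_generated_adjoin:
  assumes N: "N \<lhd> G" and fg: "subgroups_finitely_generated N"
    and c: "c \<in> carrier G" and central: "\<And>x. x \<in> carrier G \<Longrightarrow> comm G c x \<in> N"
  shows "\<exists>N'. N' \<lhd> G \<and> subgroups_finitely_generated N' \<and> N \<subseteq> N' \<and> c \<in> N'"
proof -
  define Q \<phi> where "Q = G Mod N" and "\<phi> = (\<lambda>x. N #> x)"
  interpret N: normal N G by fact
  interpret \<phi>: group_hom G Q \<phi>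
    unfolding group_hom_def group_hom_axioms_def Q_def \<phi>_def
    using N.factorgroup_is_group N.r_coset_hom_Mod group_axioms by blast
  have one_Q: "\<one>\<^bsub>Q\<^esub> = N" by (simp add: Q_def FactGroup_def)
  have ker: "\<phi> x = \<one>\<^bsub>Q\<^esub> \<longleftrightarrow> x \<in> N" if "x \<in> carrier G" for x
    using coset_join1[OF _ that N.subgroup_axioms] N.rcos_const[OF group_axioms]
    unfolding one_Q \<phi>_def by blast
  have \<phi>_comm: "\<phi> x \<otimes>\<^bsub>Q\<^esub> \<phi> c = \<phi> c \<otimes>\<^bsub>Q\<^esub> \<phi> x" if x: "x \<in> carrier G" for x
  proof -
    have "c \<otimes> x = x \<otimes> c \<otimes> comm G c x" using c x by (simp add: comm_def m_assoc)
    then have "\<phi> (c \<otimes> x) = \<phi> (x \<otimes> c) \<otimes>\<^bsub>Q\<^esub> \<phi> (comm G c x)" using c x by simp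
    also have "\<phi> (comm G c x) = \<one>\<^bsub>Q\<^esub>" using ker[of "comm G c x"] central[OF x] c x by simp
    finally show ?thesis using c x by simp
  qed
  define N' where "N' = {x \<in> carrier G. \<exists>k::int. \<phi> x = \<phi> c [^]\<^bsub>Q\<^esub> k}"
  have sub: "subgroup N' G"
  proof (rule subgroup.intro)
    show "\<one> \<in> N'" unfolding N'_def using \<phi>.hom_one by (auto intro!: exI[of _ 0])
    show "x \<otimes> y \<in> N'" if "x \<in> N'" "y \<in> N'" for x y
      using that c unfolding N'_def by (auto simp flip: \<phi>.int_pow_mult)
    show "inv x \<in> N'" if "x \<in> N'" for x
      using that c unfolding N'_def by (auto simp flip: \<phi>.int_pow_neg)
  qed (auto simp: N'_def)
  have "N' \<lhd> G"
  proof (rule normal_invI[OF sub])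
    fix x y assume x: "x \<in> carrier G" and "y \<in> N'"
    then obtain k :: int where y: "y \<in> carrier G" and k: "\<phi> y = \<phi> c [^]\<^bsub>Q\<^esub> k"
      by (auto simp: N'_def)
    have "\<phi> x \<otimes>\<^bsub>Q\<^esub> \<phi> c [^]\<^bsub>Q\<^esub> k = \<phi> c [^]\<^bsub>Q\<^esub> k \<otimes>\<^bsub>Q\<^esub> \<phi> x"
      by (rule \<phi>.int_pow_commutes) (use x c \<phi>_comm in auto)
    then have "\<phi> (x \<otimes> y \<otimes> inv x) = \<phi> c [^]\<^bsub>Q\<^esub> k"
      using x y c k by (simp add: \<phi>.m_assoc)
    then show "x \<otimes> y \<otimes> inv x \<in> N'" using x y unfolding N'_def by blast
  qed
  moreover have "N \<subseteq> N'"
  proof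
    fix x assume x: "x \<in> N"
    then have "x \<in> carrier G" "\<phi> x = \<phi> c [^]\<^bsub>Q\<^esub> (0::int)" using ker[of x] N.subset by auto
    then show "x \<in> N'" unfolding N'_def by blast
  qed
  moreover have "c \<in> N'"
    unfolding N'_def using c by (auto intro!: exI[of _ "1::int"])
  moreover have "subgroups_finitely_generated N'"
    unfolding subgroups_finitely_generated_def
  proof (intro allI impI, elim conjE)
    fix H assume H: "subgroup H G" and HN': "H \<subseteq> N'"
    interpret H: subgroup H G by fact
    have "subgroup (H \<inter> N) G" by (rule subgroups_Inter_pair[OF H N.subgroup_axioms])
    then obtain T where T: "finite T" "T \<subseteq> H \<inter> N" "H \<inter> N = generate G T"
      using fg unfolding subgroups_finitely_generated_def by (meson inf_le2)
    define J where "J = {k::int. \<exists>x\<in>H. \<phi> x = \<phi> c [^]\<^bsub>Q\<^esub> k}"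
    have "J \<noteq> {}" unfolding J_def using \<phi>.hom_one H.one_closed
        by (auto intro!: exI[of _ "0::int"] bexI[of _ \<one>])
    moreover have "k - l \<in> J" if "k \<in> J" "l \<in> J" for k l
    proof -
      from that
      obtain x y where x: "x \<in> H" "\<phi> x = \<phi> c [^]\<^bsub>Q\<^esub> k" and y: "y \<in> H" "\<phi> y = \<phi> c [^]\<^bsub>Q\<^esub> l"
        unfolding J_def by blast
      then have "\<phi> (x \<otimes> inv y) = \<phi> c [^]\<^bsub>Q\<^esub> (k - l)"
        using c by (simp add: \<phi>.int_pow_diff)
      then show ?thesis unfolding J_def using x y by blast
    qed
    ultimately obtain d where d: "d \<in> J" and dvd: "\<forall>k\<in>J. d dvd k"
      using int_subgroup_principal[of J] by blast
    then obtain y where y: "y \<in> H" "\<phi> y = \<phi> c [^]\<^bsub>Q\<^esub> d" unfolding J_def by blast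
    have "H = generate G (insert y T)"
    proof
      show "generate G (insert y T) \<subseteq> H"
        by (rule generate_subgroup_incl[OF _ H]) (use y T in auto)
      show "H \<subseteq> generate G (insert y T)"
      proof
        fix x assume x: "x \<in> H"
        then obtain k :: int where k: "\<phi> x = \<phi> c [^]\<^bsub>Q\<^esub> k" using HN' by (auto simp: N'_def)
        then have "k \<in> J" using x by (auto simp: J_def)
        then obtain m where m: "k = d * m" using dvd by blast
        define z where "z = y [^] m"
        have gen: "subgroup (generate G (insert y T)) G"
          by (rule generate_is_subgroup) (use y T H.subset in auto)
        have z: "z \<in> generate G (insert y T)"
          unfolding z_def by (rule subgroup_int_pow_closed[OF gen]) (auto intro: generate.incl)
        have zH: "z \<in> H" unfolding z_def by (rule subgroup_int_pow_closed[OF H y(1)])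
        have "\<phi> z = \<phi> x"
          unfolding z_def k m using y c by (simp add: \<phi>.hom_int_pow \<phi>.int_pow_pow)
        then have "\<phi> (x \<otimes> inv z) = \<one>\<^bsub>Q\<^esub>" using x zH by simp
        then have "x \<otimes> inv z \<in> N" using ker[of "x \<otimes> inv z"] x zH H.subset by blast
        then have "x \<otimes> inv z \<in> H \<inter> N" using x zH by simp
        then have "x \<otimes> inv z \<in> generate G (insert y T)"
          using T(3) mono_generate[of T "insert y T"] by blast
        from subgroup.m_closed[OF gen this z] show "x \<in> generate G (insert y T)"
          using x zH by (simp add: m_assoc)
      qed
    qed
    then show "\<exists>T. finite T \<and> T \<subseteq> H \<and> H = generate G T"
      using T y by (intro exI[of _ "insert y T"]) auto
  qed
  ultimately show ?thesis by blast
qed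

text \<open>Modulo \<open>N\<close>, the elements that commute with \<open>c\<close> form a subgroup.\<close>

lemma comm_mem_of_generators:
  assumes N: "N \<lhd> G" and c: "c \<in> carrier G" and S: "S \<subseteq> carrier G"
    and comm: "\<And>s. s \<in> S \<Longrightarrow> comm G c s \<in> N" and x: "x \<in> generate G S"
  shows "comm G c x \<in> N"
  using x
proof induction
  interpret N: normal N G by fact
  {
    case one
    then show ?case using c by (simp add: comm_def)
  next
    case (incl s)
    then show ?case by (rule comm)
  next
    case (inv s)
    have "s \<otimes> inv (comm G c s) \<otimes> inv s \<in> N"
      using N.inv_op_closed2 comm[OF inv] inv S by blast
    then show ?case using comm_inv_right[OF c] inv S by auto
  next
    case (eng x y)
    have xy: "x \<in> carrier G" "y \<in> carrier G"
      using eng(1,2) generate_in_carrier[OF S] by auto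
    show ?case
      unfolding comm_mult_right[OF c xy] using N.inv_op_closed1[OF xy(2) eng(3)] eng(4) by blast
  }
qed

text \<open>\<open>Z\<close> witnesses nilpotency: commutators with arbitrary elements descend through it. The iterated
  commutators \<open>C i\<close> of the generators form finite sets, the elements of \<open>C i\<close> are central modulo any
  normal subgroup containing \<open>C (i + 1)\<close>, and \<open>C n\<close> is trivial. So, starting from the trivial group,
  all of \<open>C (n - 1), \<dots>, C 0\<close> can be adjoined one element at a time.\<close>

lemma nilpotent_subgroups_finitely_generated:
  assumes S: "finite S" "S \<subseteq> carrier G" "carrier G = generate G S"
    and Z0: "carrier G \<subseteq> Z 0" and Zn: "Z n \<subseteq> {\<one>}"
    and Z: "\<And>i x y. x \<in> Z i \<Longrightarrow> x \<in> carrier G \<Longrightarrow> y \<in> carrier G \<Longrightarrow> comm G x y \<in> Z (Suc i)"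
  shows "subgroups_finitely_generated (carrier G)"
proof -
  define C where "C = rec_nat S (\<lambda>_ B. (\<lambda>(c, s). comm G c s) ` (B \<times> S))"
  have C0: "C 0 = S" and CS: "C (Suc i) = (\<lambda>(c, s). comm G c s) ` (C i \<times> S)" for i
    by (simp_all add: C_def)
  have C: "finite (C i) \<and> C i \<subseteq> carrier G \<and> C i \<subseteq> Z i" for i
  proof (induction i)
    case 0
    then show ?case using S Z0 by (auto simp: C0)
  next
    case (Suc i)
    then show ?case using S(1,2) Z unfolding CS by (auto simp: subset_iff)
  qed
  define good where "good N \<longleftrightarrow> N \<lhd> G \<and> subgroups_finitely_generated N" for N
  have step: "\<exists>N'. good N' \<and> C i \<subseteq> N'" if N: "good N" "C (Suc i) \<subseteq> N" for i N
  proof -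
    have "\<exists>N'. good N' \<and> N \<subseteq> N' \<and> B \<subseteq> N'" if "finite B" "B \<subseteq> C i" for B
      using that
    proof (induction B rule: finite_induct)
      case empty
      then show ?case using N by blast
    next
      case (insert c B)
      then obtain M where M: "good M" "N \<subseteq> M" "B \<subseteq> M" by blast
      have c: "c \<in> carrier G" "c \<in> C i" using insert.prems C by blast+
      have "comm G c s \<in> M" if "s \<in> S" for s
        using c(2) that N(2) M(2) unfolding CS by auto
      then have "comm G c x \<in> M" if "x \<in> carrier G" for x
        using comm_mem_of_generators[OF _ c(1) S(2)] that S(3) M(1) unfolding good_def by blast
      then obtain N' where "good N'" "M \<subseteq> N'" "c \<in> N'"
        using subgroups_finitely_generated_adjoin[OF _ _ c(1)] M(1) unfolding good_def by blast
      then show ?case using M by blast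
    qed
    from this[of "C i"] C show ?thesis by blast
  qed
  have "\<exists>N. good N \<and> C (n - k) \<subseteq> N" for k
  proof (induction k)
    case 0
    have "good {\<one>}"
      unfolding good_def subgroups_finitely_generated_def
    proof (intro conjI allI impI one_is_normal)
      fix H assume "subgroup H G \<and> H \<subseteq> {\<one>}"
      then have "H = {\<one>}" using subgroup.one_closed by blast
      then show "\<exists>T. finite T \<and> T \<subseteq> H \<and> H = generate G T"
        by (intro exI[of _ "{}"]) (simp add: generate_empty)
    qed
    then show ?case using C[of n] Zn by auto
  next
    case (Suc k)
    then obtain N where N: "good N" "C (n - k) \<subseteq> N" by blast
    show ?case
    proof (cases "k < n")
      case True
      then have "n - k = Suc (n - Suc k)" by simp
      then show ?thesis using step N by metis
    next
      case False
      then show ?thesis using N by auto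
    qed
  qed
  from this[of n] obtain N where N: "good N" "S \<subseteq> N" unfolding C0[symmetric] by auto
  have "carrier G \<subseteq> N"
    using generate_subgroup_incl[OF N(2)] N(1) S(3) normal_imp_subgroup unfolding good_def by blast
  then show ?thesis
    using N(1) unfolding good_def subgroups_finitely_generated_def by blast
qed

text \<open>The union of a chain of subgroups has a finite set of generators, which lies in one member of
  the chain; so the chain has a largest element and Zorn's lemma applies.\<close>

lemma subgroups_maximal_element:
  assumes fg: "subgroups_finitely_generated (carrier G)"
    and ne: "\<A> \<noteq> {}" and sub: "\<And>H. H \<in> \<A> \<Longrightarrow> subgroup H G"
  shows "\<exists>M\<in>\<A>. \<forall>H\<in>\<A>. M \<subseteq> H \<longrightarrow> H = M"
proof (rule subset_Zorn_nonempty[OF ne])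
  fix \<C> assume ne: "\<C> \<noteq> {}" and chain: "subset.chain \<A> \<C>"
  then have sub': "\<And>H. H \<in> \<C> \<Longrightarrow> subgroup H G"
    and lin: "\<And>H H'. H \<in> \<C> \<Longrightarrow> H' \<in> \<C> \<Longrightarrow> H \<subseteq> H' \<or> H' \<subseteq> H"
    using sub unfolding subset.chain_def by blast+
  have U: "subgroup (\<Union>\<C>) G"
  proof (rule subgroup.intro)
    show "\<Union>\<C> \<subseteq> carrier G" using subgroup.subset[OF sub'] by (rule Union_least)
    show "\<one> \<in> \<Union>\<C>" using ne subgroup.one_closed[OF sub'] by blast
    show "inv x \<in> \<Union>\<C>" if "x \<in> \<Union>\<C>" for x
      using that subgroup.m_inv_closed[OF sub'] by (meson UnionE UnionI)
    show "x \<otimes> y \<in> \<Union>\<C>" if "x \<in> \<Union>\<C>" "y \<in> \<Union>\<C>" for x y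
    proof -
      from that lin obtain H where H: "H \<in> \<C>" "x \<in> H" "y \<in> H" by (meson UnionE subsetD)
      from subgroup.m_closed[OF sub'[OF H(1)] H(2,3)] H(1) show ?thesis by (rule UnionI[rotated])
    qed
  qed
  obtain T where T: "finite T" "T \<subseteq> \<Union>\<C>" "\<Union>\<C> = generate G T"
    using fg[unfolded subgroups_finitely_generated_def, rule_format,
        OF conjI[OF U subgroup.subset[OF U]]] by blast
  then obtain H where H: "H \<in> \<C>" "T \<subseteq> H"
    using finite_subset_Union_chain[OF T(1,2) ne chain] by blast
  have "\<Union>\<C> = H"
    using generate_subgroup_incl[OF H(2) sub'[OF H(1)]] T(3) H(1) by blast
  then show "\<Union>\<C> \<in> \<A>" using H(1) chain unfolding subset.chain_def by blast
qed

end

section \<open>The commutator calculus of polynomial maps\<close>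

lemma prefiltrationD:
  assumes "prefiltration A G"
  shows "group A" "subgroup (G i) A" "G (Suc i) \<subseteq> G i"
  using assms by (auto simp: prefiltration_def)

lemma prefiltration_comm:
  assumes "prefiltration A G" "x \<in> G i" "y \<in> G j"
  shows "comm A x y \<in> G (i + j)"
proof -
  have "comm A x y \<in> commutator_subgroup A (G i) (G j)"
    unfolding commutator_subgroup_def comm_def using assms(2,3)
    by (intro generate.incl) blast
  then show ?thesis using assms(1) unfolding prefiltration_def by blast
qed

lemma prefiltration_antimono:
  assumes "prefiltration A G" "i \<le> j"
  shows "G j \<subseteq> G i"
  using assms(2) prefiltrationD(3)[OF assms(1)] by (rule lift_Suc_antimono_le[rotated])

text \<open>Only \<open>r\<close> successive derivatives are controlled, and \<open>k\<close> counts the shifts of the prefiltration.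
  The truncation parameter makes it possible to prove closure properties by upward induction on \<open>r\<close>,
  simultaneously for all \<open>k\<close>.\<close>

primrec truncated_polynomial ::
  "('g, 'm) monoid_scheme \<Rightarrow> (nat \<Rightarrow> 'g set) \<Rightarrow> nat \<Rightarrow> nat \<Rightarrow> (nat fset \<Rightarrow> 'g) \<Rightarrow> bool"
  where
    "truncated_polynomial A G 0 k g \<longleftrightarrow> (\<forall>\<beta>. g \<beta> \<in> G k)"
  | "truncated_polynomial A G (Suc r) k g \<longleftrightarrow> (\<forall>\<beta>. g \<beta> \<in> G k) \<and>
      (\<forall>\<alpha>. \<exists>D. truncated_polynomial A G r (Suc k) D \<and>
        (\<forall>\<beta>. \<alpha> |\<inter>| \<beta> = {||} \<longrightarrow> D \<beta> = inv\<^bsub>A\<^esub> (g \<beta>) \<otimes>\<^bsub>A\<^esub> g (\<alpha> |\<union>| \<beta>)))"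

context
  fixes A :: "('g, 'm) monoid_scheme" (structure) and G :: "nat \<Rightarrow> 'g set"
  assumes pre: "prefiltration A G"
begin

interpretation A: group A
  using prefiltrationD(1)[OF pre] .

lemma G_carrier: "x \<in> G i \<Longrightarrow> x \<in> carrier A"
  using subgroup.mem_carrier[OF prefiltrationD(2)[OF pre]] .

lemma truncated_polynomial_values: "truncated_polynomial A G r k g \<Longrightarrow> g \<beta> \<in> G k"
  by (cases r) auto

lemma truncated_polynomial_SucE:
  assumes "truncated_polynomial A G (Suc r) k g"
  obtains D where "truncated_polynomial A G r (Suc k) D"
    and "\<And>\<beta>. \<alpha> |\<inter>| \<beta> = {||} \<Longrightarrow> D \<beta> = inv (g \<beta>) \<otimes> g (\<alpha> |\<union>| \<beta>)"
  using assms unfolding truncated_polynomial.simps(2) by blast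

lemma truncated_polynomial_less_levels:
  "truncated_polynomial A G (Suc r) k g \<Longrightarrow> truncated_polynomial A G r k g"
proof (induction r arbitrary: k g)
  case (Suc r)
  show ?case
    unfolding truncated_polynomial.simps(2)[of A G r]
  proof (intro conjI allI)
    show "g \<beta> \<in> G k" for \<beta>
      using truncated_polynomial_values[OF Suc.prems] .
    show "\<exists>D. truncated_polynomial A G r (Suc k) D \<and>
        (\<forall>\<beta>. \<alpha> |\<inter>| \<beta> = {||} \<longrightarrow> D \<beta> = inv (g \<beta>) \<otimes> g (\<alpha> |\<union>| \<beta>))" for \<alpha>
      by (rule truncated_polynomial_SucE[OF Suc.prems, of \<alpha>]) (use Suc.IH in blast)
  qed
qed simp

lemma truncated_polynomial_lower:
  "truncated_polynomial A G r k' g \<Longrightarrow> k \<le> k' \<Longrightarrow> truncated_polynomial A G r k g"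
proof (induction r arbitrary: k k' g)
  case 0
  then show ?case using prefiltration_antimono[OF pre] by auto
next
  case (Suc r)
  have le: "Suc k \<le> Suc k'" using Suc.prems(2) by simp
  show ?case
    unfolding truncated_polynomial.simps(2)
  proof (intro conjI allI)
    show "g \<beta> \<in> G k" for \<beta>
      using truncated_polynomial_values[OF Suc.prems(1)]
        prefiltration_antimono[OF pre Suc.prems(2)] by blast
    show "\<exists>D. truncated_polynomial A G r (Suc k) D \<and>
        (\<forall>\<beta>. \<alpha> |\<inter>| \<beta> = {||} \<longrightarrow> D \<beta> = inv (g \<beta>) \<otimes> g (\<alpha> |\<union>| \<beta>))" for \<alpha>
      by (rule truncated_polynomial_SucE[OF Suc.prems(1), of \<alpha>]) (use Suc.IH[OF _ le] in blast)
  qed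
qed

lemma truncated_polynomial_const:
  "c \<in> G k \<Longrightarrow> truncated_polynomial A G r k (\<lambda>_. c)"
proof (induction r arbitrary: k c)
  case (Suc r)
  have "\<one> \<in> G (Suc k)"
    by (rule subgroup.one_closed[OF prefiltrationD(2)[OF pre]])
  from Suc.IH[OF this] Suc.prems show ?case
    by (auto intro!: exI[of _ "\<lambda>_. \<one>"] simp: G_carrier)
qed simp

text \<open>The three closure properties need each other. The derivative of a product involves the
  commutator of a factor with a derivative; the derivative of a commutator \<open>c\<close> is a product of
  commutators, some of which contain \<open>c\<close> itself. An induction on the degree would be circular here,
  but in an induction on the number \<open>r\<close> of controlled derivatives the map \<open>c\<close> may be used with one
  derivative less.\<close>

lemma truncated_polynomial_group:
  shows "truncated_polynomial A G r i g \<Longrightarrow> truncated_polynomial A G r i h \<Longrightarrow>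
      truncated_polynomial A G r i (\<lambda>\<beta>. g \<beta> \<otimes> h \<beta>)"
    and "truncated_polynomial A G r i g \<Longrightarrow> truncated_polynomial A G r i (\<lambda>\<beta>. inv (g \<beta>))"
    and "truncated_polynomial A G r i g \<Longrightarrow> truncated_polynomial A G r j h \<Longrightarrow>
      truncated_polynomial A G r (i + j) (\<lambda>\<beta>. comm A (g \<beta>) (h \<beta>))"
proof (induction r arbitrary: i j g h)
  case 0
  {
    case 1 then show ?case
      using subgroup.m_closed[OF prefiltrationD(2)[OF pre]] by auto
  next
    case 2 then show ?case
      using subgroup.m_inv_closed[OF prefiltrationD(2)[OF pre]] by auto
  next
    case 3 then show ?case
      using prefiltration_comm[OF pre] by auto
  }
next
  case (Suc r)
  note mult = Suc.IH(1) and inverse = Suc.IH(2) and comm = Suc.IH(3)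
  note lower = truncated_polynomial_lower and fewer = truncated_polynomial_less_levels
  note val = truncated_polynomial_values
  {
    case 1
    note g = 1(1) and h = 1(2)
    show ?case
      unfolding truncated_polynomial.simps(2)
    proof (intro conjI allI)
      show "g \<beta> \<otimes> h \<beta> \<in> G i" for \<beta>
        using subgroup.m_closed[OF prefiltrationD(2)[OF pre] val[OF g] val[OF h]] .
      fix \<alpha>
      obtain a where a: "truncated_polynomial A G r (Suc i) a"
        and a_eq: "\<And>\<beta>. \<alpha> |\<inter>| \<beta> = {||} \<Longrightarrow> a \<beta> = inv (g \<beta>) \<otimes> g (\<alpha> |\<union>| \<beta>)"
        by (rule truncated_polynomial_SucE[OF g, of \<alpha>]) blast
      obtain b where b: "truncated_polynomial A G r (Suc i) b"
        and b_eq: "\<And>\<beta>. \<alpha> |\<inter>| \<beta> = {||} \<Longrightarrow> b \<beta> = inv (h \<beta>) \<otimes> h (\<alpha> |\<union>| \<beta>)"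
        by (rule truncated_polynomial_SucE[OF h, of \<alpha>]) blast
      have "truncated_polynomial A G r (Suc i) (\<lambda>\<beta>. comm A (a \<beta>) (h \<beta>))"
        by (rule lower[OF comm[OF a fewer[OF h]]]) simp
      from mult[OF mult[OF a this] b]
      show "\<exists>D. truncated_polynomial A G r (Suc i) D \<and>
          (\<forall>\<beta>. \<alpha> |\<inter>| \<beta> = {||} \<longrightarrow>
            D \<beta> = inv (g \<beta> \<otimes> h \<beta>) \<otimes> (g (\<alpha> |\<union>| \<beta>) \<otimes> h (\<alpha> |\<union>| \<beta>)))"
        using val[OF g, THEN G_carrier] val[OF h, THEN G_carrier]
        by (intro exI[of _ "\<lambda>\<beta>. a \<beta> \<otimes> comm A (a \<beta>) (h \<beta>) \<otimes> b \<beta>"] conjI allI impI)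
          (auto simp: a_eq b_eq comm_def A.m_assoc A.inv_mult_group)
    qed
  next
    case 2
    note g = 2
    show ?case
      unfolding truncated_polynomial.simps(2)
    proof (intro conjI allI)
      show "inv (g \<beta>) \<in> G i" for \<beta>
        using subgroup.m_inv_closed[OF prefiltrationD(2)[OF pre] val[OF g]] .
      fix \<alpha>
      obtain a where a: "truncated_polynomial A G r (Suc i) a"
        and a_eq: "\<And>\<beta>. \<alpha> |\<inter>| \<beta> = {||} \<Longrightarrow> a \<beta> = inv (g \<beta>) \<otimes> g (\<alpha> |\<union>| \<beta>)"
        by (rule truncated_polynomial_SucE[OF g, of \<alpha>]) blast
      note a' = inverse[OF a]
      have "truncated_polynomial A G r (Suc i) (\<lambda>\<beta>. comm A (inv (a \<beta>)) (inv (g \<beta>)))"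
        by (rule lower[OF comm[OF a' inverse[OF fewer[OF g]]]]) simp
      from mult[OF a' this]
      show "\<exists>D. truncated_polynomial A G r (Suc i) D \<and>
          (\<forall>\<beta>. \<alpha> |\<inter>| \<beta> = {||} \<longrightarrow> D \<beta> = inv (inv (g \<beta>)) \<otimes> inv (g (\<alpha> |\<union>| \<beta>)))"
        using val[OF g, THEN G_carrier]
        by (intro exI[of _ "\<lambda>\<beta>. inv (a \<beta>) \<otimes> comm A (inv (a \<beta>)) (inv (g \<beta>))"]
            conjI allI impI)
          (auto simp: a_eq comm_def A.m_assoc A.inv_mult_group)
    qed
  next
    case 3
    note g = 3(1) and h = 3(2)
    show ?case
      unfolding truncated_polynomial.simps(2)
    proof (intro conjI allI)
      show "comm A (g \<beta>) (h \<beta>) \<in> G (i + j)" for \<beta>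
        using prefiltration_comm[OF pre val[OF g] val[OF h]] .
      fix \<alpha>
      obtain a where a: "truncated_polynomial A G r (Suc i) a"
        and a_eq: "\<And>\<beta>. \<alpha> |\<inter>| \<beta> = {||} \<Longrightarrow> a \<beta> = inv (g \<beta>) \<otimes> g (\<alpha> |\<union>| \<beta>)"
        by (rule truncated_polynomial_SucE[OF g, of \<alpha>]) blast
      obtain b where b: "truncated_polynomial A G r (Suc j) b"
        and b_eq: "\<And>\<beta>. \<alpha> |\<inter>| \<beta> = {||} \<Longrightarrow> b \<beta> = inv (h \<beta>) \<otimes> h (\<alpha> |\<union>| \<beta>)"
        by (rule truncated_polynomial_SucE[OF h, of \<alpha>]) blast
      note g' = fewer[OF g] and h' = fewer[OF h]
      define c y z where "c = (\<lambda>\<beta>. comm A (g \<beta>) (h \<beta>))"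
        and "y = (\<lambda>\<beta>. comm A (g \<beta> \<otimes> a \<beta>) (b \<beta>))"
        and "z = (\<lambda>\<beta>. comm A (g \<beta> \<otimes> a \<beta>) (h \<beta>))"
      have ga: "truncated_polynomial A G r i (\<lambda>\<beta>. g \<beta> \<otimes> a \<beta>)"
        by (rule mult[OF g' lower[OF a]]) simp
      have c: "truncated_polynomial A G r (i + j) c"
        unfolding c_def by (rule comm[OF g' h'])
      have y: "truncated_polynomial A G r (Suc (i + j)) y"
        unfolding y_def by (rule lower[OF comm[OF ga b]]) simp
      have z: "truncated_polynomial A G r (i + j) z"
        unfolding z_def by (rule comm[OF ga h'])
      have yc: "truncated_polynomial A G r (Suc (i + j)) (\<lambda>\<beta>. comm A (y \<beta>) (c \<beta>))"
        by (rule lower[OF comm[OF y c]]) simp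
      have ca: "truncated_polynomial A G r (Suc (i + j)) (\<lambda>\<beta>. comm A (c \<beta>) (a \<beta>))"
        by (rule lower[OF comm[OF c a]]) simp
      have ah: "truncated_polynomial A G r (Suc (i + j)) (\<lambda>\<beta>. comm A (a \<beta>) (h \<beta>))"
        by (rule lower[OF comm[OF a h']]) simp
      have zb: "truncated_polynomial A G r (Suc (i + j)) (\<lambda>\<beta>. comm A (z \<beta>) (b \<beta>))"
        by (rule lower[OF comm[OF z b]]) simp
      let ?D = "\<lambda>\<beta>. y \<beta> \<otimes> comm A (y \<beta>) (c \<beta>) \<otimes> comm A (c \<beta>) (a \<beta>) \<otimes>
        comm A (a \<beta>) (h \<beta>) \<otimes> comm A (z \<beta>) (b \<beta>)"
      have "truncated_polynomial A G r (Suc (i + j)) ?D"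
        by (rule mult[OF mult[OF mult[OF mult[OF y yc] ca] ah] zb])
      moreover have "?D \<beta> = inv (c \<beta>) \<otimes> comm A (g (\<alpha> |\<union>| \<beta>)) (h (\<alpha> |\<union>| \<beta>))"
        if "\<alpha> |\<inter>| \<beta> = {||}" for \<beta>
      proof -
        note carr = val[OF g, THEN G_carrier] val[OF h, THEN G_carrier]
          val[OF a, THEN G_carrier] val[OF b, THEN G_carrier]
        have "g (\<alpha> |\<union>| \<beta>) = g \<beta> \<otimes> a \<beta>" "h (\<alpha> |\<union>| \<beta>) = h \<beta> \<otimes> b \<beta>"
          using a_eq[OF that] b_eq[OF that] carr by simp_all
        then show ?thesis
          using A.comm_mult_mult[OF carr[of \<beta>]] unfolding c_def y_def z_def by simp
      qed
      ultimately show "\<exists>D. truncated_polynomial A G r (Suc (i + j)) D \<and>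
          (\<forall>\<beta>. \<alpha> |\<inter>| \<beta> = {||} \<longrightarrow> D \<beta> = inv (comm A (g \<beta>) (h \<beta>)) \<otimes>
            comm A (g (\<alpha> |\<union>| \<beta>)) (h (\<alpha> |\<union>| \<beta>)))"
        unfolding c_def by blast
    qed
  }
qed

text \<open>A conjugate is the product of the map with its commutator with a constant, and constants from
  \<open>G 0\<close> are polynomial.\<close>

lemma truncated_polynomial_conj:
  assumes "truncated_polynomial A G r k g" "c \<in> G 0"
  shows "truncated_polynomial A G r k (\<lambda>\<beta>. inv c \<otimes> g \<beta> \<otimes> c)"
proof -
  note const = truncated_polynomial_const[OF assms(2)]
  have "truncated_polynomial A G r k (\<lambda>\<beta>. comm A (g \<beta>) c)"
    using truncated_polynomial_group(3)[OF assms(1) const] by simp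
  from truncated_polynomial_group(1)[OF assms(1) this] show ?thesis
    using truncated_polynomial_values[OF assms(1), THEN G_carrier] G_carrier[OF assms(2)]
    by (simp add: A.conj_eq_mult_comm)
qed

lemma polynomial_map_imp_truncated:
  "polynomial_map A G' g \<Longrightarrow> G' = (\<lambda>i. G (i + k)) \<Longrightarrow> truncated_polynomial A G r k g"
proof (induction arbitrary: k r rule: polynomial_map.induct)
  case (trivial G' g)
  have "g = (\<lambda>_. \<one>)" using trivial(2) by blast
  moreover have "\<one> \<in> G k"
    by (rule subgroup.one_closed[OF prefiltrationD(2)[OF pre]])
  ultimately show ?case using truncated_polynomial_const by blast
next
  case (derivative g G')
  have vals: "\<forall>\<beta>. g \<beta> \<in> G k"
    using derivative(1) unfolding derivative.prems by simp
  show ?case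
  proof (cases r)
    case 0
    then show ?thesis using vals by simp
  next
    case (Suc s)
    have sh: "shift G' = (\<lambda>i. G (i + Suc k))" by (simp add: shift_def derivative.prems)
    show ?thesis
      unfolding Suc truncated_polynomial.simps(2)
    proof (intro conjI vals allI)
      show "\<exists>D. truncated_polynomial A G s (Suc k) D \<and>
          (\<forall>\<beta>. \<alpha> |\<inter>| \<beta> = {||} \<longrightarrow> D \<beta> = inv (g \<beta>) \<otimes> g (\<alpha> |\<union>| \<beta>))" for \<alpha>
        using derivative(2) sh by blast
    qed
  qed
qed

text \<open>Once the truncation reaches the trivial group, truncated polynomials are polynomials.\<close>

lemma truncated_imp_polynomial_map:
  assumes "G n = {\<one>}"
  shows "truncated_polynomial A G r k g \<Longrightarrow> n = k + r \<Longrightarrow> polynomial_map A (\<lambda>i. G (i + k)) g"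
proof (induction r arbitrary: k g)
  case 0
  then show ?case using assms by (auto intro!: polynomial_map.trivial)
next
  case (Suc r)
  have sh: "shift (\<lambda>i. G (i + k)) = (\<lambda>i. G (i + Suc k))" by (auto simp: shift_def)
  have n: "n = Suc k + r" using Suc.prems by simp
  show ?case
  proof (rule polynomial_map.derivative)
    show "\<forall>\<beta>. g \<beta> \<in> G (0 + k)"
      using truncated_polynomial_values[OF Suc.prems(1)] by simp
    show "\<forall>\<alpha>. \<exists>Dg. polynomial_map A (shift (\<lambda>i. G (i + k))) Dg \<and>
        (\<forall>\<beta>. \<alpha> |\<inter>| \<beta> = {||} \<longrightarrow> Dg \<beta> = inv (g \<beta>) \<otimes> g (\<alpha> |\<union>| \<beta>))"
    proof
      fix \<alpha>
      show "\<exists>Dg. polynomial_map A (shift (\<lambda>i. G (i + k))) Dg \<and>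
          (\<forall>\<beta>. \<alpha> |\<inter>| \<beta> = {||} \<longrightarrow> Dg \<beta> = inv (g \<beta>) \<otimes> g (\<alpha> |\<union>| \<beta>))"
        by (rule truncated_polynomial_SucE[OF Suc.prems(1), of \<alpha>])
          (use Suc.IH[OF _ n] sh in auto)
    qed
  qed
qed

end

section \<open>Complex inner products\<close>

lemma cinner_add_right: "cinner x (y + z) = cinner x y + cinner (x::'h::complex_hilbert) z"
  by (metis cinner_add_left cinner_commute complex_cnj_add)

lemma cinner_scaleC_right: "cinner x (c *\<^sub>C y) = cnj c * cinner (x::'h::complex_hilbert) y"
  by (metis cinner_scaleC_left cinner_commute complex_cnj_mult)

lemma cinner_zero [simp]: "cinner 0 y = 0" "cinner y 0 = 0" for y :: "'h::complex_hilbert"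
  using cinner_add_left[of 0 0 y] cinner_add_right[of y 0 0] by simp_all

lemma cinner_minus: "cinner (- x) y = - cinner x y" "cinner x (- y) = - cinner x y"
  for x y :: "'h::complex_hilbert"
  using cinner_add_left[of x "- x" y] cinner_add_right[of x y "- y"] by (simp_all add: eq_neg_iff_add_eq_0 add.commute)

lemma cinner_diff: "cinner (x - y) z = cinner x z - cinner y z" "cinner z (x - y) = cinner z x - cinner z y"
  for x y z :: "'h::complex_hilbert"
  using cinner_add_left[of x "- y" z] cinner_add_right[of z x "- y"] by (simp_all add: cinner_minus)

lemma cinner_sum: "cinner (\<Sum>i\<in>I. f i) y = (\<Sum>i\<in>I. cinner (f i) y)"
  "cinner y (\<Sum>i\<in>I. f i) = (\<Sum>i\<in>I. cinner y (f i))"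
  for f :: "'i \<Rightarrow> 'h::complex_hilbert"
  by (induction I rule: infinite_finite_induct) (simp_all add: cinner_add_left cinner_add_right)

lemma cinner_self_eq_0: "cinner x x = 0 \<longleftrightarrow> x = 0" for x :: "'h::complex_hilbert"
  by (simp add: cinner_self)

lemma cinner_ext: "(\<And>u. cinner x u = cinner y u) \<Longrightarrow> x = y" for x y :: "'h::complex_hilbert"
  using cinner_self_eq_0[of "x - y"] by (simp add: cinner_diff(1))

lemma cinner_Cauchy_Schwarz: "cmod (cinner x y) \<le> norm x * norm y" for x y :: "'h::complex_hilbert"
proof (cases "y = 0")
  case False
  define c where "c = cinner x y / complex_of_real ((norm y)\<^sup>2)"
  define z where "z = x - c *\<^sub>C y"
  have zy: "cinner z y = 0"
    using False by (simp add: z_def c_def cinner_diff(1) cinner_scaleC_left cinner_self)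
  have "complex_of_real ((norm z)\<^sup>2) = cinner z x"
    unfolding cinner_self[symmetric] by (subst (2) z_def) (simp add: cinner_diff(2) cinner_scaleC_right zy)
  also have "\<dots> = complex_of_real ((norm x)\<^sup>2) - c * cnj (cinner x y)"
    by (simp add: z_def cinner_diff(1) cinner_scaleC_left cinner_self cinner_commute[of y x])
  also have "c * cnj (cinner x y) = complex_of_real ((cmod (cinner x y))\<^sup>2 / (norm y)\<^sup>2)"
    by (simp only: c_def of_real_divide complex_norm_square times_divide_eq_left)
  finally have "(norm z)\<^sup>2 = (norm x)\<^sup>2 - (cmod (cinner x y))\<^sup>2 / (norm y)\<^sup>2"
    by (simp only: of_real_diff[symmetric] of_real_eq_iff)
  then have "(cmod (cinner x y))\<^sup>2 / (norm y)\<^sup>2 \<le> (norm x)\<^sup>2"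
    by (metis diff_ge_0_iff_ge zero_le_power2)
  then have "(cmod (cinner x y))\<^sup>2 \<le> (norm x * norm y)\<^sup>2"
    using False by (simp add: field_simps)
  then show ?thesis by (rule power2_le_imp_le) simp
qed simp

lemma norm_diff_square:
  "(norm (x - y))\<^sup>2 = (norm x)\<^sup>2 - 2 * Re (cinner x y) + (norm y)\<^sup>2" for x y :: "'h::complex_hilbert"
proof -
  have "complex_of_real ((norm (x - y))\<^sup>2) = cinner x x - (cinner x y + cnj (cinner x y)) + cinner y y"
    unfolding cinner_self[symmetric] by (simp add: cinner_diff cinner_commute[of y x])
  also have "\<dots> = complex_of_real ((norm x)\<^sup>2 - 2 * Re (cinner x y) + (norm y)\<^sup>2)"
    by (simp add: cinner_self complex_add_cnj)
  finally show ?thesis by (simp only: of_real_eq_iff)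
qed

lemma cinner_left_functional: "(\<lambda>x. cinner x u) \<in> cfunctionals" for u :: "'h::complex_hilbert"
proof -
  have "bounded_linear (\<lambda>x. cinner x u)"
  proof (rule bounded_linear_intro)
    show "cinner (r *\<^sub>R x) u = r *\<^sub>R cinner x u" for r x
      using cinner_scaleC_left[of "complex_of_real r" x u]
      by (simp add: scaleC_of_real scaleR_conv_of_real)
    show "cmod (cinner x u) \<le> norm x * norm u" for x by (rule cinner_Cauchy_Schwarz)
  qed (rule cinner_add_left)
  then show ?thesis by (simp add: cfunctionals_def cinner_scaleC_left)
qed

section \<open>Limits along finite sets tending to infinity\<close>

text \<open>Convergence along this filter is the IP-limit: \<open>\<alpha> > \<alpha>\<^sub>0\<close> amounts to a lower bound on the elements
  of \<open>\<alpha>\<close>.\<close>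

definition IP_filter :: "nat fset filter"
  where "IP_filter = (INF n. principal {\<alpha>. \<alpha> \<noteq> {||} \<and> (\<forall>x. x |\<in>| \<alpha> \<longrightarrow> n \<le> x)})"

lemma eventually_IP_filter:
  "eventually Q IP_filter \<longleftrightarrow> (\<exists>n. \<forall>\<alpha>. \<alpha> \<noteq> {||} \<longrightarrow> (\<forall>x. x |\<in>| \<alpha> \<longrightarrow> n \<le> x) \<longrightarrow> Q \<alpha>)"
proof -
  have "eventually Q IP_filter \<longleftrightarrow>
    (\<exists>n\<in>UNIV. eventually Q (principal {\<alpha>. \<alpha> \<noteq> {||} \<and> (\<forall>x. x |\<in>| \<alpha> \<longrightarrow> n \<le> x)}))"
    unfolding IP_filter_def
  proof (rule eventually_INF_base)
    fix a b :: nat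
    show "\<exists>x\<in>UNIV. principal {\<alpha>. \<alpha> \<noteq> {||} \<and> (\<forall>y. y |\<in>| \<alpha> \<longrightarrow> x \<le> y)}
        \<le> inf (principal {\<alpha>. \<alpha> \<noteq> {||} \<and> (\<forall>x. x |\<in>| \<alpha> \<longrightarrow> a \<le> x)})
          (principal {\<alpha>. \<alpha> \<noteq> {||} \<and> (\<forall>x. x |\<in>| \<alpha> \<longrightarrow> b \<le> x)})"
      by (rule bexI[of _ "max a b"]) auto
  qed simp
  then show ?thesis unfolding eventually_principal by blast
qed

lemma IP_filter_neq_bot [simp]: "IP_filter \<noteq> bot"
proof -
  have "\<exists>\<alpha>. \<alpha> \<noteq> {||} \<and> (\<forall>x. x |\<in>| \<alpha> \<longrightarrow> n \<le> x)" for n :: nat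
    by (rule exI[of _ "{|n|}"]) simp
  then show ?thesis unfolding trivial_limit_def eventually_IP_filter by blast
qed

lemma eventually_IP_disjoint: "eventually (\<lambda>\<beta>. \<beta> |\<inter>| \<alpha> = {||}) IP_filter"
proof -
  obtain n where n: "\<And>x. x |\<in>| \<alpha> \<Longrightarrow> x < n"
    using finite_nat_set_iff_bounded[of "fset \<alpha>"] by auto
  show ?thesis
    unfolding eventually_IP_filter by (rule exI[of _ n]) (use n in fastforce)
qed

text \<open>Relates the limit along \<open>\<alpha> \<union> \<beta>\<close> to the iterated limit, although \<open>\<alpha> \<union> \<beta>\<close> does not tend to
  infinity when \<open>\<alpha>\<close> is fixed: the union starts where \<open>\<alpha>\<close> or \<open>\<beta>\<close> starts.\<close>

lemma eventually_IP_union: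
  assumes "eventually Q IP_filter"
  shows "eventually (\<lambda>\<alpha>. eventually (\<lambda>\<beta>. Q (\<alpha> |\<union>| \<beta>)) IP_filter) IP_filter"
proof -
  obtain n where n: "\<And>\<alpha>. \<alpha> \<noteq> {||} \<Longrightarrow> (\<forall>x. x |\<in>| \<alpha> \<longrightarrow> n \<le> x) \<Longrightarrow> Q \<alpha>"
    using assms unfolding eventually_IP_filter by blast
  show ?thesis
    unfolding eventually_IP_filter
    by (rule exI[of _ n], intro allI impI, rule exI[of _ n], intro allI impI n) auto
qed

lemma w_IP_lim_tendsto:
  assumes "w_IP_lim T P"
  shows "((\<lambda>\<alpha>. cinner (T \<alpha> f) u) \<longlongrightarrow> cinner (P f) u) IP_filter"
proof (rule topological_tendstoI)
  fix V assume V: "open V" "cinner (P f) u \<in> V"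
  define U where "U = (\<lambda>x. cinner x u) -` V"
  have "openin weak_top U"
    unfolding weak_top_def U_def
    by (rule topology_generated_by_Basis) (use V(1) cinner_left_functional in blast)
  moreover have "P f \<in> U" using V(2) by (simp add: U_def)
  ultimately have "\<exists>\<alpha>0. \<alpha>0 \<noteq> {||} \<and> (\<forall>\<alpha>. \<alpha> \<noteq> {||} \<and> \<alpha>0 \<lless> \<alpha> \<longrightarrow> T \<alpha> f \<in> U)"
    using assms[unfolded w_IP_lim_def, rule_format, OF conjI] by simp
  then obtain \<alpha>0 where \<alpha>0: "\<And>\<alpha>. \<alpha> \<noteq> {||} \<Longrightarrow> \<alpha>0 \<lless> \<alpha> \<Longrightarrow> T \<alpha> f \<in> U"
    by blast
  have "T \<alpha> f \<in> U" if "\<alpha> \<noteq> {||}" "\<forall>x. x |\<in>| \<alpha> \<longrightarrow> Suc (fMax \<alpha>0) \<le> x" for \<alpha>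
  proof (rule \<alpha>0[OF that(1)])
    have "fMin \<alpha> |\<in>| \<alpha>" by (rule fMin_in[OF that(1)])
    then show "\<alpha>0 \<lless> \<alpha>" unfolding fin_less_def using that(2) by (simp add: Suc_le_eq)
  qed
  then show "eventually (\<lambda>\<alpha>. cinner (T \<alpha> f) u \<in> V) IP_filter"
    unfolding eventually_IP_filter U_def by blast
qed

lemma tendsto_frequently_eq:
  fixes f g :: "'a \<Rightarrow> 'b::t2_space"
  assumes "(f \<longlongrightarrow> a) \<FF>" "(g \<longlongrightarrow> b) \<FF>" "frequently (\<lambda>x. f x = g x) \<FF>"
  shows "a = b"
proof (rule ccontr)
  assume "a \<noteq> b"
  then obtain U V where "open U" "open V" "a \<in> U" "b \<in> V" "U \<inter> V = {}"
    using hausdorff by metis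
  then have "eventually (\<lambda>x. f x \<in> U) \<FF>" "eventually (\<lambda>x. g x \<in> V) \<FF>"
    using assms(1,2) by (auto dest: topological_tendstoD)
  then have "eventually (\<lambda>x. f x \<noteq> g x) \<FF>"
    by eventually_elim (use \<open>U \<inter> V = {}\<close> in auto)
  then show False using assms(3) by (simp add: frequently_def)
qed

text \<open>The sets are the final segments \<open>\<gamma> m = {s m, \<dots>, s (N - 1)}\<close> of a rapidly increasing sequence \<open>s\<close>.
  Then \<open>\<gamma> m\<close> is the union of \<open>\<alpha> = {s m, \<dots>, s (n - 1)}\<close> and \<open>\<gamma> n\<close>, and the rapid growth puts \<open>\<gamma> n\<close>
  beyond the threshold that \<open>\<alpha>\<close> requires.\<close>

lemma van_der_Corput_sets:
  fixes R :: "nat fset \<Rightarrow> nat fset \<Rightarrow> bool"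
  assumes R: "eventually (\<lambda>\<alpha>. eventually (\<lambda>\<beta>. R (\<alpha> |\<union>| \<beta>) \<beta>) IP_filter) IP_filter"
    and Q: "eventually Q IP_filter"
  obtains \<gamma> :: "nat \<Rightarrow> nat fset" where "\<And>m. m < N \<Longrightarrow> Q (\<gamma> m)"
    and "\<And>m n. m < n \<Longrightarrow> n < N \<Longrightarrow> R (\<gamma> m) (\<gamma> n)"
proof -
  obtain n1 where n1: "\<And>\<alpha>. \<alpha> \<noteq> {||} \<Longrightarrow> (\<forall>x. x |\<in>| \<alpha> \<longrightarrow> n1 \<le> x) \<Longrightarrow>
      eventually (\<lambda>\<beta>. R (\<alpha> |\<union>| \<beta>) \<beta>) IP_filter"
    using R[unfolded eventually_IP_filter[of "\<lambda>\<alpha>. eventually (\<lambda>\<beta>. R (\<alpha> |\<union>| \<beta>) \<beta>) IP_filter"]]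
    by blast
  obtain n2 where n2: "\<And>\<alpha>. \<alpha> \<noteq> {||} \<Longrightarrow> (\<forall>x. x |\<in>| \<alpha> \<longrightarrow> n2 \<le> x) \<Longrightarrow> Q \<alpha>"
    using Q unfolding eventually_IP_filter by blast
  define n0 where "n0 = max n1 n2"
  define t where "t \<alpha> = (SOME k. \<forall>\<beta>. \<beta> \<noteq> {||} \<longrightarrow> (\<forall>x. x |\<in>| \<beta> \<longrightarrow> k \<le> x) \<longrightarrow> R (\<alpha> |\<union>| \<beta>) \<beta>)" for \<alpha>
  have t: "R (\<alpha> |\<union>| \<beta>) \<beta>"
    if "\<alpha> \<noteq> {||}" "\<forall>x. x |\<in>| \<alpha> \<longrightarrow> n0 \<le> x" "\<beta> \<noteq> {||}" "\<forall>x. x |\<in>| \<beta> \<longrightarrow> t \<alpha> \<le> x" for \<alpha> \<beta>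
  proof -
    have "\<exists>k. \<forall>\<beta>. \<beta> \<noteq> {||} \<longrightarrow> (\<forall>x. x |\<in>| \<beta> \<longrightarrow> k \<le> x) \<longrightarrow> R (\<alpha> |\<union>| \<beta>) \<beta>"
      using n1[OF that(1)] that(2) unfolding n0_def eventually_IP_filter by simp
    from someI_ex[OF this] that(3,4) show ?thesis unfolding t_def by blast
  qed
  \<comment> \<open>a common bound for the thresholds of all subsets of \<open>{0..k}\<close>\<close>
  define T where "T k = Suc k + (\<Sum>\<alpha>\<in>fset (fPow (fset_of_list [0..<Suc k])). t \<alpha>)" for k
  define s where "s j = (T ^^ j) n0" for j
  have s_Suc: "s (Suc j) = T (s j)" and s_0: "s 0 = n0" for j by (simp_all add: s_def)
  have "s j < s (Suc j)" for j unfolding s_Suc T_def by simp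
  then have mono: "strict_mono s" by (simp add: strict_mono_Suc_iff)
  have ge: "n0 \<le> s j" for j using s_0 strict_mono_less_eq[OF mono, of 0 j] by simp
  define \<gamma> where "\<gamma> m = s |`| fset_of_list [m..<N]" for m
  have mem: "x |\<in>| \<gamma> m \<longleftrightarrow> (\<exists>j. m \<le> j \<and> j < N \<and> x = s j)" for x m
    unfolding \<gamma>_def by (auto simp: fset_of_list_elem)
  have ne: "\<gamma> m \<noteq> {||}" if "m < N" for m using mem[of "s m" m] that by auto
  show ?thesis
  proof (rule that[of \<gamma>])
    show "Q (\<gamma> m)" if "m < N" for m
      using n2[OF ne[OF that]] ge unfolding mem n0_def by fastforce
    fix m n assume mn: "m < n" "n < N"
    define \<alpha> where "\<alpha> = s |`| fset_of_list [m..<n]"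
    have mem': "x |\<in>| \<alpha> \<longleftrightarrow> (\<exists>j. m \<le> j \<and> j < n \<and> x = s j)" for x
      unfolding \<alpha>_def by (auto simp: fset_of_list_elem)
    obtain n' where n': "n = Suc n'" using mn(1) by (cases n) auto
    have "\<gamma> m = \<alpha> |\<union>| \<gamma> n"
      using upt_add_eq_append[of m n "N - n"] mn unfolding \<gamma>_def \<alpha>_def by (simp add: fimage_funion)
    moreover have "t \<alpha> \<le> x" if x: "x |\<in>| \<gamma> n" for x
    proof -
      have "\<alpha> |\<subseteq>| fset_of_list [0..<Suc (s n')]"
      proof
        fix x assume "x |\<in>| \<alpha>"
        then obtain j where "j \<le> n'" "x = s j" unfolding mem' n' less_Suc_eq_le by blast
        then have "x \<le> s n'" using strict_mono_less_eq[OF mono] by simp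
        then show "x |\<in>| fset_of_list [0..<Suc (s n')]"
          by (auto simp: fset_of_list_elem)
      qed
      then have "t \<alpha> \<le> (\<Sum>\<alpha>\<in>fset (fPow (fset_of_list [0..<Suc (s n')])). t \<alpha>)"
        by (intro member_le_sum) (simp_all only: fPow_iff finite_fset zero_le)
      also have "\<dots> \<le> s n" unfolding n' s_Suc T_def by simp
      also have "s n \<le> x"
      proof -
        from x obtain j where "n \<le> j" "x = s j" unfolding mem by blast
        then show ?thesis using strict_mono_less_eq[OF mono] by simp
      qed
      finally show ?thesis .
    qed
    moreover have "\<alpha> \<noteq> {||}" using mem'[of "s m"] mn by auto
    moreover have "\<forall>x. x |\<in>| \<alpha> \<longrightarrow> n0 \<le> x" using ge by (auto simp: mem')
    ultimately show "R (\<gamma> m) (\<gamma> n)" using t[of \<alpha> "\<gamma> n"] ne[OF mn(2)] by simp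
  qed
qed

text \<open>Along the sets of \<open>van_der_Corput_sets\<close> the vectors \<open>x\<close> are nearly orthogonal in pairs, so
  their sum \<open>v\<close> over \<open>N\<close> sets has squared norm at most \<open>N C\<^sup>2 + N\<^sup>2 \<epsilon>\<close>. On the other hand
  \<open>\<langle>v, u\<rangle>\<close> is at least \<open>N \<bar>c\<bar> / 2\<close> in absolute value, which contradicts the Cauchy--Schwarz
  inequality for large \<open>N\<close>.\<close>

lemma van_der_Corput:
  fixes x :: "nat fset \<Rightarrow> 'h::complex_hilbert"
  assumes bound: "\<And>\<alpha>. norm (x \<alpha>) \<le> C"
    and corr: "eventually (\<lambda>\<alpha>. ((\<lambda>\<beta>. cinner (x (\<alpha> |\<union>| \<beta>)) (x \<beta>)) \<longlongrightarrow> 0) IP_filter) IP_filter"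
    and lim: "((\<lambda>\<alpha>. cinner (x \<alpha>) u) \<longlongrightarrow> c) IP_filter"
  shows "c = 0"
proof (rule ccontr)
  assume "c \<noteq> 0"
  then have c: "cmod c > 0" by simp
  define \<epsilon> where "\<epsilon> = (cmod c)\<^sup>2 / (16 * ((norm u)\<^sup>2 + 1))"
  have u1: "(norm u)\<^sup>2 + 1 > 0" by (simp add: add_nonneg_pos)
  have \<epsilon>: "\<epsilon> > 0" unfolding \<epsilon>_def using c u1 by simp
  obtain N' :: nat where "C\<^sup>2 / \<epsilon> < N'"
    using reals_Archimedean2 by blast
  then obtain N :: nat where N: "N > 0" "C\<^sup>2 / \<epsilon> < N"
    by (intro that[of "Suc N'"]) auto
  have "eventually (\<lambda>\<alpha>. eventually (\<lambda>\<beta>. cmod (cinner (x (\<alpha> |\<union>| \<beta>)) (x \<beta>)) < \<epsilon>) IP_filter) IP_filter"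
    using corr by eventually_elim (use \<epsilon> in \<open>auto dest!: tendstoD simp: dist_norm\<close>)
  moreover have "eventually (\<lambda>\<alpha>. cmod (cinner (x \<alpha>) u - c) < cmod c / 2) IP_filter"
    using tendstoD[OF lim, of "cmod c / 2"] c by (simp add: dist_norm)
  ultimately obtain \<gamma> :: "nat \<Rightarrow> nat fset"
    where \<gamma>1: "\<And>m. m < N \<Longrightarrow> cmod (cinner (x (\<gamma> m)) u - c) < cmod c / 2"
      and \<gamma>2: "\<And>m n. m < n \<Longrightarrow> n < N \<Longrightarrow> cmod (cinner (x (\<gamma> m)) (x (\<gamma> n))) < \<epsilon>"
    by (rule van_der_Corput_sets[where R = "\<lambda>\<alpha> \<beta>. cmod (cinner (x \<alpha>) (x \<beta>)) < \<epsilon>"]) blast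
  define v where "v = (\<Sum>m<N. x (\<gamma> m))"
  have "complex_of_real ((norm v)\<^sup>2) = (\<Sum>m<N. \<Sum>n<N. cinner (x (\<gamma> m)) (x (\<gamma> n)))"
    unfolding cinner_self[symmetric] v_def by (simp add: cinner_sum) (rule sum.swap)
  then have "(norm v)\<^sup>2 = cmod (\<Sum>m<N. \<Sum>n<N. cinner (x (\<gamma> m)) (x (\<gamma> n)))"
    by (metis norm_of_real abs_of_nonneg zero_le_power2)
  also have "\<dots> \<le> (\<Sum>m<N. \<Sum>n<N. cmod (cinner (x (\<gamma> m)) (x (\<gamma> n))))"
    by (intro order_trans[OF norm_sum] sum_mono norm_sum)
  also have "\<dots> \<le> (\<Sum>m<N. \<Sum>n<N. \<epsilon> + (if m = n then C\<^sup>2 else 0))"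
  proof (intro sum_mono)
    fix m n assume mn: "m \<in> {..<N}" "n \<in> {..<N}"
    consider "m < n" | "n < m" | "m = n" by linarith
    then show "cmod (cinner (x (\<gamma> m)) (x (\<gamma> n))) \<le> \<epsilon> + (if m = n then C\<^sup>2 else 0)"
    proof cases
      case 1
      then show ?thesis using \<gamma>2[of m n] mn by simp
    next
      case 2
      have "cmod (cinner (x (\<gamma> m)) (x (\<gamma> n))) = cmod (cinner (x (\<gamma> n)) (x (\<gamma> m)))"
        by (metis cinner_commute complex_mod_cnj)
      then show ?thesis using \<gamma>2[of n m] mn 2 by simp
    next
      case 3
      have "(norm (x (\<gamma> m)))\<^sup>2 \<le> C\<^sup>2" by (intro power_mono bound) simp
      then show ?thesis using 3 \<epsilon> by (simp add: cinner_self norm_power)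
    qed
  qed
  also have "\<dots> = real N * (real N * \<epsilon> + C\<^sup>2)"
    by (simp add: sum.distrib algebra_simps)
  also have "\<dots> \<le> real N * (real N * \<epsilon> + real N * \<epsilon>)"
    using N \<epsilon> by (intro mult_left_mono add_left_mono) (simp_all add: field_simps)
  finally have v: "(norm v)\<^sup>2 \<le> 2 * \<epsilon> * (real N)\<^sup>2"
    by (simp add: power2_eq_square algebra_simps)
  have "cinner v u = (\<Sum>m<N. cinner (x (\<gamma> m)) u - c) + of_nat N * c"
    unfolding v_def by (simp add: cinner_sum sum_subtractf)
  then have "real N * cmod c = cmod (cinner v u - (\<Sum>m<N. cinner (x (\<gamma> m)) u - c))"
    by (simp add: norm_mult)
  also have "\<dots> \<le> cmod (cinner v u) + cmod (\<Sum>m<N. cinner (x (\<gamma> m)) u - c)"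
    by (rule norm_triangle_ineq4)
  also have "cmod (\<Sum>m<N. cinner (x (\<gamma> m)) u - c) \<le> (\<Sum>m<N. cmod c / 2)"
    by (rule sum_norm_le) (use \<gamma>1 in \<open>simp add: less_imp_le\<close>)
  also have "(\<Sum>m<N. cmod c / 2) = real N * cmod c / 2" by simp
  also have "cmod (cinner v u) \<le> norm v * norm u" by (rule cinner_Cauchy_Schwarz)
  finally have "real N * cmod c / 2 \<le> norm v * norm u" by linarith
  then have "(real N * cmod c / 2)\<^sup>2 \<le> (norm v * norm u)\<^sup>2"
    by (intro power_mono) simp_all
  also have "\<dots> = (norm v)\<^sup>2 * (norm u)\<^sup>2" by (simp add: power_mult_distrib)
  also have "\<dots> \<le> (2 * \<epsilon> * (real N)\<^sup>2) * ((norm u)\<^sup>2 + 1)"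
    using v \<epsilon> by (intro mult_mono) auto
  also have "\<dots> = (real N)\<^sup>2 * (cmod c)\<^sup>2 / 8"
  proof -
    have "\<epsilon> * ((norm u)\<^sup>2 + 1) = (cmod c)\<^sup>2 / 16"
      unfolding \<epsilon>_def using u1 by (simp add: field_simps)
    then have "2 * (real N)\<^sup>2 * (\<epsilon> * ((norm u)\<^sup>2 + 1)) = 2 * (real N)\<^sup>2 * ((cmod c)\<^sup>2 / 16)"
      by (rule arg_cong)
    then show ?thesis by (simp only: mult_ac)
  qed
  finally have "(real N * cmod c / 2)\<^sup>2 \<le> (real N)\<^sup>2 * (cmod c)\<^sup>2 / 8" .
  moreover have "(real N * cmod c / 2)\<^sup>2 = (real N)\<^sup>2 * (cmod c)\<^sup>2 / 4"
    by (simp add: power_mult_distrib power_divide)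
  moreover have "(real N)\<^sup>2 * (cmod c)\<^sup>2 > 0" using N(1) c by simp
  ultimately show False by linarith
qed

lemma eventually_IP_nonempty: "\<forall>\<^sub>F \<alpha> in IP_filter. \<alpha> \<noteq> {||}"
  by (simp add: eventually_IP_filter)

section \<open>Weak limits of unitary families\<close>

text \<open>What follows from the existence of the weak limits \<open>P g\<close> and the group structure of \<open>F\<close> alone,
  before polynomials enter.\<close>

locale unitary_IP_family =
  fixes A :: "('g, 'm) monoid_scheme" (structure)
    and K :: "'g set"
    and \<pi> :: "'g \<Rightarrow> 'h::complex_hilbert \<Rightarrow> 'h"
    and F :: "(nat fset \<Rightarrow> 'g) set"
    and P :: "(nat fset \<Rightarrow> 'g) \<Rightarrow> 'h \<Rightarrow> 'h"
  assumes group_A: "group A"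
    and K: "subgroup K A"
    and action_mult: "a \<in> K \<Longrightarrow> b \<in> K \<Longrightarrow> \<pi> (a \<otimes> b) x = \<pi> a (\<pi> b x)"
    and action_one: "\<pi> \<one> x = x"
    and action_linear: "a \<in> K \<Longrightarrow> clinear_op (\<pi> a)"
    and action_cinner: "a \<in> K \<Longrightarrow> cinner (\<pi> a x) (\<pi> a y) = cinner x y"
    and F_values: "g \<in> F \<Longrightarrow> g \<alpha> \<in> K"
    and F_one: "(\<lambda>_. \<one>) \<in> F"
    and F_mult: "g \<in> F \<Longrightarrow> h \<in> F \<Longrightarrow> (\<lambda>\<alpha>. g \<alpha> \<otimes> h \<alpha>) \<in> F"
    and F_inv: "g \<in> F \<Longrightarrow> (\<lambda>\<alpha>. inv (g \<alpha>)) \<in> F"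
    and weak_limit: "g \<in> F \<Longrightarrow> ((\<lambda>\<alpha>. cinner (\<pi> (g \<alpha>) f) u) \<longlongrightarrow> cinner (P g f) u) IP_filter"
begin

interpretation A: group A by (rule group_A)

lemma K_closed: "a \<in> K \<Longrightarrow> a \<in> carrier A" "a \<in> K \<Longrightarrow> b \<in> K \<Longrightarrow> a \<otimes> b \<in> K" "a \<in> K \<Longrightarrow> inv a \<in> K"
  using K by (auto simp: subgroup.mem_carrier subgroup.m_closed subgroup.m_inv_closed)

lemma action_add: "a \<in> K \<Longrightarrow> \<pi> a (x + y) = \<pi> a x + \<pi> a y"
  and action_scaleC: "a \<in> K \<Longrightarrow> \<pi> a (c *\<^sub>C x) = c *\<^sub>C \<pi> a x"
  using action_linear unfolding clinear_op_def by blast+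

lemma action_diff: "a \<in> K \<Longrightarrow> \<pi> a (x - y) = \<pi> a x - \<pi> a y"
  using action_add[of a "x - y" y] by (simp add: eq_diff_eq)

lemma action_zero: "a \<in> K \<Longrightarrow> \<pi> a 0 = 0"
  using action_diff[of a 0 0] by simp

lemma action_inv: "a \<in> K \<Longrightarrow> \<pi> (inv a) (\<pi> a x) = x"
  using action_mult[of "inv a" a x] by (simp add: K_closed action_one)

lemma action_norm: "a \<in> K \<Longrightarrow> norm (\<pi> a x) = norm x"
  using action_cinner[of a x x] unfolding cinner_self of_real_eq_iff by simp

lemma action_adjoint: "a \<in> K \<Longrightarrow> cinner (\<pi> a x) y = cinner x (\<pi> (inv a) y)"
  using action_cinner[of "inv a" "\<pi> a x" y] by (simp add: action_inv K_closed)

lemma limit_adjoint: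
  assumes "g \<in> F"
  shows "cinner (P g f) u = cinner f (P (\<lambda>\<alpha>. inv (g \<alpha>)) u)"
proof (rule tendsto_unique[OF IP_filter_neq_bot weak_limit[OF assms]])
  have "((\<lambda>\<alpha>. cnj (cinner (\<pi> (inv (g \<alpha>)) u) f)) \<longlongrightarrow> cnj (cinner (P (\<lambda>\<alpha>. inv (g \<alpha>)) u) f)) IP_filter"
    by (rule tendsto_cnj[OF weak_limit[OF F_inv[OF assms]]])
  then show "((\<lambda>\<alpha>. cinner (\<pi> (g \<alpha>) f) u) \<longlongrightarrow> cinner f (P (\<lambda>\<alpha>. inv (g \<alpha>)) u)) IP_filter"
    using F_values[OF assms] by (simp add: action_adjoint flip: cinner_commute)
qed

lemma limit_linear:
  assumes "g \<in> F"
  shows "clinear_op (P g)"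
  unfolding clinear_op_def
proof (intro conjI allI)
  note lim = weak_limit[OF assms] and uniq = tendsto_unique[OF IP_filter_neq_bot weak_limit[OF assms]]
  show "P g (x + y) = P g x + P g y" for x y
  proof (rule cinner_ext, rule uniq)
    show "((\<lambda>\<alpha>. cinner (\<pi> (g \<alpha>) (x + y)) u) \<longlongrightarrow> cinner (P g x + P g y) u) IP_filter" for u
      using tendsto_add[OF lim[of x u] lim[of y u]]
      by (simp add: action_add F_values[OF assms] cinner_add_left)
  qed
  show "P g (c *\<^sub>C x) = c *\<^sub>C P g x" for c x
  proof (rule cinner_ext, rule uniq)
    show "((\<lambda>\<alpha>. cinner (\<pi> (g \<alpha>) (c *\<^sub>C x)) u) \<longlongrightarrow> cinner (c *\<^sub>C P g x) u) IP_filter" for u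
      using tendsto_mult_left[OF lim[of x u], of c]
      by (simp add: action_scaleC F_values[OF assms] cinner_scaleC_left)
  qed
qed

lemma limit_zero: "g \<in> F \<Longrightarrow> P g 0 = 0"
  using limit_linear[of g] unfolding clinear_op_def by (metis add_cancel_left_right)

lemma limit_norm_le:
  assumes "g \<in> F"
  shows "norm (P g f) \<le> norm f"
proof -
  have "cmod (cinner (P g f) (P g f)) \<le> norm f * norm (P g f)"
  proof (rule tendsto_upperbound[OF tendsto_norm[OF weak_limit[OF assms]]])
    show "\<forall>\<^sub>F \<alpha> in IP_filter. cmod (cinner (\<pi> (g \<alpha>) f) (P g f)) \<le> norm f * norm (P g f)"
    proof (rule always_eventually, rule allI)
      show "cmod (cinner (\<pi> (g \<alpha>) f) (P g f)) \<le> norm f * norm (P g f)" for \<alpha>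
        using cinner_Cauchy_Schwarz[of "\<pi> (g \<alpha>) f" "P g f"] by (simp add: action_norm F_values[OF assms])
    qed
  qed simp
  then have "norm (P g f) * norm (P g f) \<le> norm f * norm (P g f)"
    by (simp add: cinner_self power2_eq_square norm_mult)
  then show ?thesis by (cases "P g f = 0") auto
qed

text \<open>For unitary operators weak convergence to a vector of the same norm is strong convergence.\<close>

lemma fixed_imp_strong_limit:
  assumes "k \<in> F" "P k v = v"
  shows "((\<lambda>\<beta>. norm (\<pi> (k \<beta>) v - v)) \<longlongrightarrow> 0) IP_filter"
proof -
  have "((\<lambda>\<beta>. Re (cinner (\<pi> (k \<beta>) v) v)) \<longlongrightarrow> Re (cinner v v)) IP_filter"
    using weak_limit[OF assms(1), of v v] unfolding assms(2) by (rule tendsto_Re)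
  from tendsto_diff[OF tendsto_const[of "2 * (norm v)\<^sup>2"] tendsto_mult_left[OF this, of 2]]
  have "((\<lambda>\<beta>. (norm (\<pi> (k \<beta>) v - v))\<^sup>2) \<longlongrightarrow> 0) IP_filter"
    by (simp add: norm_diff_square action_norm F_values[OF assms(1)] cinner_self)
  from tendsto_real_sqrt[OF this] show ?thesis by simp
qed

text \<open>Strong convergence of \<open>k\<close> at \<open>v\<close> allows \<open>k\<close> to be inserted under unitary operators that vary
  with \<open>\<beta>\<close>, which weak convergence would not.\<close>

lemma limit_insert_fixed:
  assumes k: "k \<in> F" "P k v = v" and a: "\<And>\<beta>. a \<beta> \<in> K"
    and lim: "((\<lambda>\<beta>. cinner (\<pi> (a \<beta>) v) u) \<longlongrightarrow> c) IP_filter"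
  shows "((\<lambda>\<beta>. cinner (\<pi> (a \<beta>) (\<pi> (k \<beta>) v)) u) \<longlongrightarrow> c) IP_filter"
proof -
  have "((\<lambda>\<beta>. cinner (\<pi> (a \<beta>) (\<pi> (k \<beta>) v)) u - cinner (\<pi> (a \<beta>) v) u) \<longlongrightarrow> 0) IP_filter"
  proof (rule Lim_null_comparison)
    show "((\<lambda>\<beta>. norm (\<pi> (k \<beta>) v - v) * norm u) \<longlongrightarrow> 0) IP_filter"
      using tendsto_mult_right[OF fixed_imp_strong_limit[OF k], of "norm u"] by simp
    show "\<forall>\<^sub>F \<beta> in IP_filter. cmod (cinner (\<pi> (a \<beta>) (\<pi> (k \<beta>) v)) u - cinner (\<pi> (a \<beta>) v) u)
        \<le> norm (\<pi> (k \<beta>) v - v) * norm u"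
    proof (rule always_eventually, rule allI)
      fix \<beta>
      show "cmod (cinner (\<pi> (a \<beta>) (\<pi> (k \<beta>) v)) u - cinner (\<pi> (a \<beta>) v) u)
          \<le> norm (\<pi> (k \<beta>) v - v) * norm u"
        using cinner_Cauchy_Schwarz[of "\<pi> (a \<beta>) (\<pi> (k \<beta>) v - v)" u]
        unfolding action_norm[OF a] by (simp add: action_diff[OF a] cinner_diff)
    qed
  qed
  from tendsto_add[OF this lim] show ?thesis by simp
qed

lemma limit_mult_fixed:
  assumes "g \<in> F" "k \<in> F" "P k v = v"
  shows "P (\<lambda>\<alpha>. g \<alpha> \<otimes> k \<alpha>) v = P g v"
proof (rule cinner_ext, rule tendsto_unique[OF IP_filter_neq_bot weak_limit[OF F_mult[OF assms(1,2)]]])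
  show "((\<lambda>\<alpha>. cinner (\<pi> (g \<alpha> \<otimes> k \<alpha>) v) u) \<longlongrightarrow> cinner (P g v) u) IP_filter" for u
    using limit_insert_fixed[OF assms(2,3) F_values[OF assms(1)] weak_limit[OF assms(1)]]
    by (simp add: action_mult F_values assms)
qed

lemma limit_one: "P (\<lambda>_. \<one>) v = v"
  by (rule cinner_ext, rule tendsto_unique[OF IP_filter_neq_bot weak_limit[OF F_one]])
    (simp add: action_one)

lemma limit_inv_fixed:
  assumes "k \<in> F" "P k v = v"
  shows "P (\<lambda>\<alpha>. inv (k \<alpha>)) v = v"
  using limit_mult_fixed[OF F_inv[OF assms(1)] assms] F_values[OF assms(1)]
  by (simp add: K_closed limit_one)

lemma limit_conj:
  assumes "g \<in> F" "c \<in> K" "(\<lambda>\<alpha>. inv c \<otimes> g \<alpha> \<otimes> c) \<in> F"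
  shows "P g (\<pi> c v) = \<pi> c (P (\<lambda>\<alpha>. inv c \<otimes> g \<alpha> \<otimes> c) v)"
proof (rule cinner_ext, rule tendsto_unique[OF IP_filter_neq_bot weak_limit[OF assms(1)]])
  fix u
  have "cinner (\<pi> (g \<alpha>) (\<pi> c v)) u = cinner (\<pi> (inv c \<otimes> g \<alpha> \<otimes> c) v) (\<pi> (inv c) u)" for \<alpha>
    using assms F_values[OF assms(1), of \<alpha>]
    by (simp add: action_mult K_closed action_cinner)
  then show "((\<lambda>\<alpha>. cinner (\<pi> (g \<alpha>) (\<pi> c v)) u) \<longlongrightarrow>
      cinner (\<pi> c (P (\<lambda>\<alpha>. inv c \<otimes> g \<alpha> \<otimes> c) v)) u) IP_filter"
    using weak_limit[OF assms(3), of v "\<pi> (inv c) u"] by (simp add: action_adjoint[OF assms(2)])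
qed

text \<open>\<open>P h\<close> has an adjoint and is therefore weakly continuous, so both sides of the hypothesis converge
  weakly; since the limits are known to exist, agreement for arbitrarily late \<open>\<alpha>\<close> identifies them.\<close>

lemma limit_of_frequently_eq:
  assumes "g \<in> F" "h \<in> F"
    and "\<exists>\<^sub>F \<alpha> in IP_filter. P h (\<pi> (g \<alpha>) v) = \<pi> (g \<alpha>) w"
  shows "P h (P g v) = P g w"
proof (rule cinner_ext)
  fix u
  have "((\<lambda>\<alpha>. cinner (P h (\<pi> (g \<alpha>) v)) u) \<longlongrightarrow> cinner (P h (P g v)) u) IP_filter"
    unfolding limit_adjoint[OF assms(2)] by (rule weak_limit[OF assms(1)])
  then show "cinner (P h (P g v)) u = cinner (P g w) u"
    by (rule tendsto_frequently_eq[OF _ weak_limit[OF assms(1)]])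
      (use assms(3) in \<open>auto elim: frequently_elim1\<close>)
qed

text \<open>If \<open>g\<close> fixes a vector in the limit, so does its inverse. Hence the adjoint of \<open>P g\<close> is the
  identity on the range of \<open>P g\<close>, which makes \<open>P g\<close> self-adjoint.\<close>

lemma orthogonal_projectionI:
  assumes g: "g \<in> F" and idem: "\<And>v. P g (P g v) = P g v"
  shows "orthogonal_projection (P g)"
proof -
  note lin = limit_linear[OF g, unfolded clinear_op_def]
  have "bounded_linear (P g)"
  proof (rule bounded_linear_intro)
    show "P g (r *\<^sub>R x) = r *\<^sub>R P g x" for r x
      using lin by (simp flip: scaleC_of_real)
    show "norm (P g x) \<le> norm x * 1" for x using limit_norm_le[OF g] by simp
  qed (use lin in blast)
  moreover have sym: "cinner (P g x) (P g y) = cinner x (P g y)" for x y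
    using limit_adjoint[OF g, of x "P g y"] limit_inv_fixed[OF g idem] by simp
  have "cinner (P g x) y = cinner x (P g y)" for x y
    by (metis sym cinner_commute)
  ultimately show ?thesis
    using limit_linear[OF g] idem by (auto simp: orthogonal_projection_def)
qed

end

section \<open>Projections for a group, given those for its derivatives\<close>

text \<open>One step of the induction: \<open>E\<close> is the group to be treated, and \<open>L\<close> is a group containing the
  derivatives of members of \<open>E\<close> and their commutators with values of members of \<open>E\<close>, for which the
  theorem is known. In the condition on derivatives \<open>k \<beta>\<close> stands last, so that it is
  the first to act on a vector; this \<open>k\<close> is the symmetric derivative conjugated by \<open>g \<alpha>\<close>. The maximality condition is
  the ascending chain condition for subgroups of \<open>L\<close>.\<close>

locale derivative_step = unitary_IP_family A K \<pi> F P
  for A :: "('g, 'm) monoid_scheme" (structure) and K \<pi> F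
    and P :: "(nat fset \<Rightarrow> 'g) \<Rightarrow> 'h::complex_hilbert \<Rightarrow> 'h" +
  fixes L E :: "(nat fset \<Rightarrow> 'g) set"
  assumes L_F: "L \<subseteq> F" and E_F: "E \<subseteq> F"
    and L_one: "(\<lambda>_. \<one>) \<in> L"
    and L_mult: "k \<in> L \<Longrightarrow> l \<in> L \<Longrightarrow> (\<lambda>\<alpha>. k \<alpha> \<otimes> l \<alpha>) \<in> L"
    and L_inv: "k \<in> L \<Longrightarrow> (\<lambda>\<alpha>. inv (k \<alpha>)) \<in> L"
    and L_conj: "k \<in> L \<Longrightarrow> c \<in> K \<Longrightarrow> (\<lambda>\<alpha>. inv c \<otimes> k \<alpha> \<otimes> c) \<in> L"
    and E_conj: "g \<in> E \<Longrightarrow> c \<in> K \<Longrightarrow> (\<lambda>\<alpha>. inv c \<otimes> g \<alpha> \<otimes> c) \<in> E"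
    and L_projection: "k \<in> L \<Longrightarrow> orthogonal_projection (P k)"
    and L_commute: "k \<in> L \<Longrightarrow> l \<in> L \<Longrightarrow> P k \<circ> P l = P l \<circ> P k"
    and L_maximal: "\<A> \<noteq> {} \<Longrightarrow>
      (\<And>H. H \<in> \<A> \<Longrightarrow> H \<subseteq> L \<and> (\<lambda>_. \<one>) \<in> H \<and>
        (\<forall>k\<in>H. \<forall>l\<in>H. (\<lambda>\<alpha>. k \<alpha> \<otimes> l \<alpha>) \<in> H) \<and> (\<forall>k\<in>H. (\<lambda>\<alpha>. inv (k \<alpha>)) \<in> H)) \<Longrightarrow>
      \<exists>M\<in>\<A>. \<forall>H\<in>\<A>. M \<subseteq> H \<longrightarrow> H = M"
    and derivative: "g \<in> E \<Longrightarrow> \<forall>\<^sub>F \<alpha> in IP_filter.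
      \<exists>k\<in>L. \<forall>\<beta>. \<beta> |\<inter>| \<alpha> = {||} \<longrightarrow> g (\<alpha> |\<union>| \<beta>) = g \<beta> \<otimes> g \<alpha> \<otimes> k \<beta>"
    and commutator: "g \<in> E \<Longrightarrow> h \<in> E \<Longrightarrow>
      \<exists>k\<in>L. \<forall>\<beta>. inv (g \<alpha>) \<otimes> h \<beta> \<otimes> g \<alpha> = h \<beta> \<otimes> k \<beta>"
begin

lemma in_F: "k \<in> L \<Longrightarrow> k \<in> F" "g \<in> E \<Longrightarrow> g \<in> F"
  using L_F E_F by auto

definition homogeneous :: "'h \<Rightarrow> bool"
  where "homogeneous v \<longleftrightarrow> (\<forall>k\<in>L. P k v = v \<or> P k v = 0)"

lemma L_idem: "k \<in> L \<Longrightarrow> P k (P k v) = P k v"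
  using L_projection[of k] unfolding orthogonal_projection_def by (metis comp_apply)

lemma L_selfadjoint: "k \<in> L \<Longrightarrow> cinner (P k x) y = cinner x (P k y)"
  using L_projection[of k] unfolding orthogonal_projection_def by blast

text \<open>Projecting a vector orthogonal to all homogeneous ones by \<open>P h\<close> keeps it orthogonal to them, and
  cannot shrink its stabiliser, as the projections for \<open>L\<close> commute. So a nonzero such vector with
  maximal stabiliser would be homogeneous, hence orthogonal to itself.\<close>

lemma orthogonal_homogeneous_eq_0:
  assumes "\<And>v. homogeneous v \<Longrightarrow> cinner f v = 0"
  shows "f = 0"
proof (rule ccontr)
  assume f: "f \<noteq> 0"
  define N where "N = {f. f \<noteq> 0 \<and> (\<forall>v. homogeneous v \<longrightarrow> cinner f v = 0)}"
  define stab where "stab f = {k \<in> L. P k f = f}" for f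
  have "\<exists>M\<in>stab ` N. \<forall>H\<in>stab ` N. M \<subseteq> H \<longrightarrow> H = M"
  proof (rule L_maximal)
    show "stab ` N \<noteq> {}" using f assms unfolding N_def by blast
    fix H assume "H \<in> stab ` N"
    then obtain f where H: "H = stab f" by blast
    show "H \<subseteq> L \<and> (\<lambda>_. \<one>) \<in> H \<and>
        (\<forall>k\<in>H. \<forall>l\<in>H. (\<lambda>\<alpha>. k \<alpha> \<otimes> l \<alpha>) \<in> H) \<and> (\<forall>k\<in>H. (\<lambda>\<alpha>. inv (k \<alpha>)) \<in> H)"
      unfolding H stab_def
      by (auto simp: L_one L_mult L_inv in_F limit_one limit_mult_fixed limit_inv_fixed)
  qed
  then obtain f where f: "f \<in> N" and maximal: "\<And>f'. f' \<in> N \<Longrightarrow> stab f \<subseteq> stab f' \<Longrightarrow> stab f' = stab f"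
    by auto
  have "homogeneous f"
    unfolding homogeneous_def
  proof (intro ballI)
    fix h assume h: "h \<in> L"
    show "P h f = f \<or> P h f = 0"
    proof (rule disjCI)
      assume ne: "P h f \<noteq> 0"
      have "cinner (P h f) v = 0" if v: "homogeneous v" for v
      proof -
        have "P h v = v \<or> P h v = 0" using v h unfolding homogeneous_def by blast
        then show ?thesis using f v unfolding L_selfadjoint[OF h] N_def by auto
      qed
      then have "P h f \<in> N" using ne unfolding N_def by blast
      moreover have "stab f \<subseteq> stab (P h f)"
        unfolding stab_def using L_commute[OF h] by (auto simp: fun_eq_iff) metis
      ultimately have "stab (P h f) = stab f" by (rule maximal)
      moreover have "h \<in> stab (P h f)" unfolding stab_def using h L_idem by simp
      ultimately show "P h f = f" unfolding stab_def by blast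
    qed
  qed
  then have "cinner f f = 0" using f unfolding N_def by blast
  then show False using f unfolding N_def by (simp add: cinner_self_eq_0)
qed

text \<open>The range of \<open>T' - S'\<close> is orthogonal to all homogeneous vectors. Working with explicit adjoints
  avoids closed spans and orthogonal complements.\<close>

lemma operators_eqI:
  assumes T: "\<And>x y. cinner (T x) y = cinner x (T' y)"
    and S: "\<And>x y. cinner (S x) y = cinner x (S' y)"
    and eq: "\<And>v. homogeneous v \<Longrightarrow> T v = S v"
  shows "T x = S x"
proof (rule cinner_ext)
  fix u
  have "T' u - S' u = 0"
  proof (rule orthogonal_homogeneous_eq_0)
    fix v assume "homogeneous v"
    then have "cinner v (T' u - S' u) = 0"
      by (simp add: cinner_diff eq flip: T S)
    then show "cinner (T' u - S' u) v = 0"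
      by (metis cinner_commute complex_cnj_zero)
  qed
  then show "cinner (T x) u = cinner (S x) u" by (simp add: T S)
qed

text \<open>For fixed \<open>\<alpha>\<close> with \<open>k\<close> fixing \<open>v\<close>, the vectors \<open>g (\<alpha> \<union> \<beta>) v = g \<beta> (g \<alpha> (k \<beta> v))\<close> converge weakly to
  \<open>P g (g \<alpha> v)\<close> as \<open>\<beta>\<close> tends to infinity, which is close to \<open>P g (P g v)\<close> for late \<open>\<alpha>\<close>. But they are
  also close to \<open>P g v\<close>, uniformly in \<open>\<beta>\<close>, since \<open>\<alpha> \<union> \<beta>\<close> is late.\<close>

lemma limit_idem_if_frequently_fixed:
  assumes g: "g \<in> E"
    and freq: "\<exists>\<^sub>F \<alpha> in IP_filter. \<exists>k\<in>L. P k v = v \<and>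
      (\<forall>\<beta>. \<beta> |\<inter>| \<alpha> = {||} \<longrightarrow> g (\<alpha> |\<union>| \<beta>) = g \<beta> \<otimes> g \<alpha> \<otimes> k \<beta>)"
  shows "P g (P g v) = P g v"
proof (rule cinner_ext)
  fix u
  note gF = in_F(2)[OF g]
  have "dist (cinner (P g (P g v)) u) (cinner (P g v) u) \<le> e" if e: "e > 0" for e
  proof -
    have "\<forall>\<^sub>F \<alpha> in IP_filter. \<forall>\<^sub>F \<beta> in IP_filter.
        dist (cinner (\<pi> (g (\<alpha> |\<union>| \<beta>)) v) u) (cinner (P g v) u) < e / 2"
      by (rule eventually_IP_union) (rule tendstoD[OF weak_limit[OF gF]], use e in simp)
    moreover have "((\<lambda>\<alpha>. cinner (P g (\<pi> (g \<alpha>) v)) u) \<longlongrightarrow> cinner (P g (P g v)) u) IP_filter"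
      unfolding limit_adjoint[OF gF, of _ u] by (rule weak_limit[OF gF])
    then have "\<forall>\<^sub>F \<alpha> in IP_filter.
        dist (cinner (P g (\<pi> (g \<alpha>) v)) u) (cinner (P g (P g v)) u) < e / 2"
      by (rule tendstoD) (use e in simp)
    ultimately have "\<forall>\<^sub>F \<alpha> in IP_filter.
      dist (cinner (P g (\<pi> (g \<alpha>) v)) u) (cinner (P g (P g v)) u) < e / 2 \<and>
      (\<forall>\<^sub>F \<beta> in IP_filter. dist (cinner (\<pi> (g (\<alpha> |\<union>| \<beta>)) v) u) (cinner (P g v) u) < e / 2)"
      by eventually_elim simp
    from frequently_ex[OF frequently_eventually_frequently[OF freq this]]
    obtain \<alpha> k where k: "k \<in> L" "P k v = v"
      and rel: "\<And>\<beta>. \<beta> |\<inter>| \<alpha> = {||} \<Longrightarrow> g (\<alpha> |\<union>| \<beta>) = g \<beta> \<otimes> g \<alpha> \<otimes> k \<beta>"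
      and near1: "dist (cinner (P g (\<pi> (g \<alpha>) v)) u) (cinner (P g (P g v)) u) < e / 2"
      and near2: "\<forall>\<^sub>F \<beta> in IP_filter. dist (cinner (\<pi> (g (\<alpha> |\<union>| \<beta>)) v) u) (cinner (P g v) u) < e / 2"
      by blast
    have "((\<lambda>\<beta>. cinner (\<pi> (g \<beta> \<otimes> g \<alpha>) v) u) \<longlongrightarrow> cinner (P g (\<pi> (g \<alpha>) v)) u) IP_filter"
      using weak_limit[OF gF, of "\<pi> (g \<alpha>) v" u] by (simp add: action_mult F_values[OF gF])
    then have "((\<lambda>\<beta>. cinner (\<pi> (g \<beta> \<otimes> g \<alpha>) (\<pi> (k \<beta>) v)) u) \<longlongrightarrow> cinner (P g (\<pi> (g \<alpha>) v)) u) IP_filter"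
      by (intro limit_insert_fixed[OF in_F(1)[OF k(1)] k(2)] K_closed F_values[OF gF])
    then have "((\<lambda>\<beta>. cinner (\<pi> (g (\<alpha> |\<union>| \<beta>)) v) u) \<longlongrightarrow> cinner (P g (\<pi> (g \<alpha>) v)) u) IP_filter"
    proof (rule Lim_transform_eventually)
      show "\<forall>\<^sub>F \<beta> in IP_filter. cinner (\<pi> (g \<beta> \<otimes> g \<alpha>) (\<pi> (k \<beta>) v)) u =
          cinner (\<pi> (g (\<alpha> |\<union>| \<beta>)) v) u"
        using eventually_IP_disjoint[of \<alpha>]
        by eventually_elim (simp add: rel action_mult K_closed F_values gF in_F(1)[OF k(1)])
    qed
    then have "dist (cinner (P g (\<pi> (g \<alpha>) v)) u) (cinner (P g v) u) \<le> e / 2"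
      by (intro tendsto_upperbound[OF tendsto_dist[OF _ tendsto_const]])
        (use near2 in \<open>auto elim: eventually_mono\<close>)
    then show ?thesis
      using near1 dist_triangle3[of "cinner (P g (P g v)) u" "cinner (P g v) u"
          "cinner (P g (\<pi> (g \<alpha>) v)) u"] by linarith
  qed
  then have "dist (cinner (P g (P g v)) u) (cinner (P g v) u) \<le> 0"
    by (rule field_le_epsilon) simp
  then show "cinner (P g (P g v)) u = cinner (P g v) u" by simp
qed

text \<open>The correlation of \<open>g (\<alpha> \<union> \<beta>) v\<close> with \<open>g \<beta> v\<close> is that of \<open>k \<beta> v\<close> with a vector that does not
  depend on \<open>\<beta>\<close>, so it tends to zero.\<close>

lemma limit_eq_0_if_eventually_vanishing:
  assumes g: "g \<in> E"
    and ev: "\<forall>\<^sub>F \<alpha> in IP_filter. \<exists>k\<in>L. P k v = 0 \<and>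
      (\<forall>\<beta>. \<beta> |\<inter>| \<alpha> = {||} \<longrightarrow> g (\<alpha> |\<union>| \<beta>) = g \<beta> \<otimes> g \<alpha> \<otimes> k \<beta>)"
  shows "P g v = 0"
proof (rule cinner_ext)
  fix u
  note gF = in_F(2)[OF g]
  have "cinner (P g v) u = 0"
  proof (rule van_der_Corput[OF _ _ weak_limit[OF gF]])
    show "norm (\<pi> (g \<alpha>) v) \<le> norm v" for \<alpha> by (simp add: action_norm F_values[OF gF])
    show "\<forall>\<^sub>F \<alpha> in IP_filter.
        ((\<lambda>\<beta>. cinner (\<pi> (g (\<alpha> |\<union>| \<beta>)) v) (\<pi> (g \<beta>) v)) \<longlongrightarrow> 0) IP_filter"
      using ev
    proof eventually_elim
      case (elim \<alpha>)
      then obtain k where k: "k \<in> L" "P k v = 0"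
        and rel: "\<And>\<beta>. \<beta> |\<inter>| \<alpha> = {||} \<Longrightarrow> g (\<alpha> |\<union>| \<beta>) = g \<beta> \<otimes> g \<alpha> \<otimes> k \<beta>"
        by blast
      have "((\<lambda>\<beta>. cinner (\<pi> (k \<beta>) v) (\<pi> (inv (g \<alpha>)) v)) \<longlongrightarrow> 0) IP_filter"
        using weak_limit[OF in_F(1)[OF k(1)], of v "\<pi> (inv (g \<alpha>)) v"] unfolding k(2) by simp
      then show ?case
      proof (rule Lim_transform_eventually)
        show "\<forall>\<^sub>F \<beta> in IP_filter. cinner (\<pi> (k \<beta>) v) (\<pi> (inv (g \<alpha>)) v) =
            cinner (\<pi> (g (\<alpha> |\<union>| \<beta>)) v) (\<pi> (g \<beta>) v)"
          using eventually_IP_disjoint[of \<alpha>]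
          by eventually_elim
            (simp add: rel action_mult action_cinner action_adjoint action_inv K_closed F_values gF
              in_F(1)[OF k(1)])
      qed
    qed
  qed
  then show "cinner (P g v) u = cinner 0 u" by simp
qed

lemma limit_idem_homogeneous:
  assumes g: "g \<in> E" and v: "homogeneous v"
  shows "P g (P g v) = P g v"
proof (cases "\<exists>\<^sub>F \<alpha> in IP_filter. \<exists>k\<in>L. P k v = v \<and>
      (\<forall>\<beta>. \<beta> |\<inter>| \<alpha> = {||} \<longrightarrow> g (\<alpha> |\<union>| \<beta>) = g \<beta> \<otimes> g \<alpha> \<otimes> k \<beta>)")
  case True
  then show ?thesis by (rule limit_idem_if_frequently_fixed[OF g])
next
  case False
  have "P g v = 0"
  proof (rule limit_eq_0_if_eventually_vanishing[OF g])
    from False derivative[OF g] show "\<forall>\<^sub>F \<alpha> in IP_filter. \<exists>k\<in>L. P k v = 0 \<and>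
        (\<forall>\<beta>. \<beta> |\<inter>| \<alpha> = {||} \<longrightarrow> g (\<alpha> |\<union>| \<beta>) = g \<beta> \<otimes> g \<alpha> \<otimes> k \<beta>)"
      unfolding not_frequently
      by eventually_elim (use v in \<open>unfold homogeneous_def, blast\<close>)
  qed
  then show ?thesis by (simp add: limit_zero in_F(2)[OF g])
qed

lemma E_projection:
  assumes g: "g \<in> E"
  shows "orthogonal_projection (P g)"
proof (rule orthogonal_projectionI[OF in_F(2)[OF g]])
  note adj = limit_adjoint[OF in_F(2)[OF g]]
  let ?Q = "P (\<lambda>\<alpha>. inv (g \<alpha>))"
  show "P g (P g v) = P g v" for v
    by (rule operators_eqI[where T = "\<lambda>v. P g (P g v)" and T' = "\<lambda>u. ?Q (?Q u)"
          and S = "P g" and S' = ?Q])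
      (simp_all add: adj limit_idem_homogeneous[OF g])
qed

lemma E_idem: "g \<in> E \<Longrightarrow> P g (P g v) = P g v"
  using E_projection[of g] unfolding orthogonal_projection_def by (metis comp_apply)

lemma E_selfadjoint: "g \<in> E \<Longrightarrow> cinner (P g x) y = cinner x (P g y)"
  using E_projection[of g] unfolding orthogonal_projection_def by blast

text \<open>Invariance of the range of \<open>S\<close> under \<open>T\<close> extends from homogeneous vectors to all vectors, and
  taking adjoints in \<open>S T S = T S\<close> yields \<open>S T S = S T\<close>.\<close>

lemma commute_if_range_invariant:
  assumes S: "\<And>x y. cinner (S x) y = cinner x (S y)" and T: "\<And>x y. cinner (T x) y = cinner x (T y)"
    and inv: "\<And>v. homogeneous v \<Longrightarrow> S (T (S v)) = T (S v)"
  shows "S (T x) = T (S x)"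
proof (rule cinner_ext)
  have STS: "S (T (S x)) = T (S x)" for x
    by (rule operators_eqI[where T = "\<lambda>v. S (T (S v))" and T' = "\<lambda>v. S (T (S v))"
          and S = "\<lambda>v. T (S v)" and S' = "\<lambda>v. S (T v)"])
      (simp_all add: S T inv)
  fix u
  have "cinner (S (T x)) u = cinner x (T (S u))" by (simp add: S T)
  also have "\<dots> = cinner x (S (T (S u)))" by (simp add: STS)
  also have "\<dots> = cinner (S (T (S x))) u" by (simp add: S T)
  also have "\<dots> = cinner (T (S x)) u" by (simp add: STS)
  finally show "cinner (S (T x)) u = cinner (T (S x)) u" .
qed

text \<open>If the values vanish for all late \<open>\<alpha>\<close>, then \<open>P t (P g w) = 0\<close>, and the squared norm of \<open>P g w\<close>
  equals \<open>\<langle>P g w, w\<rangle> = \<langle>P g w, P t w\<rangle> = \<langle>P t (P g w), w\<rangle> = 0\<close>.\<close>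

lemma limit_in_range:
  assumes g: "g \<in> E" and t: "t \<in> F" and sa: "\<And>x y. cinner (P t x) y = cinner x (P t y)"
    and fixed: "P t w = w"
    and dichotomy: "\<And>\<alpha>. P t (\<pi> (g \<alpha>) w) = \<pi> (g \<alpha>) w \<or> P t (\<pi> (g \<alpha>) w) = 0"
  shows "P t (P g w) = P g w"
proof (cases "\<exists>\<^sub>F \<alpha> in IP_filter. P t (\<pi> (g \<alpha>) w) = \<pi> (g \<alpha>) w")
  case True
  then show ?thesis by (rule limit_of_frequently_eq[OF in_F(2)[OF g] t])
next
  case False
  note gF = in_F(2)[OF g]
  have "\<forall>\<^sub>F \<alpha> in IP_filter. P t (\<pi> (g \<alpha>) w) = \<pi> (g \<alpha>) 0"
    using False unfolding not_frequently
    by eventually_elim (use dichotomy action_zero[OF F_values[OF gF]] in metis)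
  then have "P t (P g w) = P g 0"
    by (intro limit_of_frequently_eq[OF gF t] eventually_frequently) auto
  then have "cinner (P t (P g w)) w = 0" by (simp add: limit_zero[OF gF])
  then have "cinner (P g (P g w)) w = 0" by (simp add: sa E_idem[OF g] fixed)
  then have "P g w = 0"
    by (simp only: E_selfadjoint[OF g, of "P g w" w] cinner_self_eq_0)
  then show ?thesis by (simp add: limit_zero[OF t])
qed

text \<open>Moving \<open>P l\<close> past \<open>g \<alpha>\<close> conjugates \<open>l\<close> by \<open>g \<alpha>\<close>, and the conjugate lies in \<open>L\<close> again, so that it
  fixes or kills a homogeneous vector.\<close>

lemma L_E_commute:
  assumes l: "l \<in> L" and g: "g \<in> E"
  shows "P l (P g x) = P g (P l x)"
proof (rule commute_if_range_invariant)
  note gF = in_F(2)[OF g] and lF = in_F(1)[OF l]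
  fix v assume v: "homogeneous v"
  show "P l (P g (P l v)) = P g (P l v)"
  proof (cases "P l v = v")
    case True
    have "P l (\<pi> (g \<alpha>) v) = \<pi> (g \<alpha>) v \<or> P l (\<pi> (g \<alpha>) v) = 0" for \<alpha>
    proof -
      note k = L_conj[OF l F_values[OF gF, of \<alpha>]]
      have "P (\<lambda>\<beta>. inv (g \<alpha>) \<otimes> l \<beta> \<otimes> g \<alpha>) v = v \<or> P (\<lambda>\<beta>. inv (g \<alpha>) \<otimes> l \<beta> \<otimes> g \<alpha>) v = 0"
        using v k unfolding homogeneous_def by blast
      then show ?thesis
        unfolding limit_conj[OF lF F_values[OF gF] in_F(1)[OF k]]
        using action_zero[OF F_values[OF gF, of \<alpha>]] by auto
    qed
    from limit_in_range[OF g lF L_selfadjoint[OF l] True this] show ?thesis by (simp add: True)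
  next
    case False
    then have "P l v = 0" using v l unfolding homogeneous_def by blast
    then show ?thesis by (simp add: limit_zero lF gF)
  qed
qed (simp_all add: L_selfadjoint[OF l] E_selfadjoint[OF g])

lemma limit_inverse_eq:
  assumes g: "g \<in> F" and sa: "\<And>x y. cinner (P g x) y = cinner x (P g y)"
  shows "P (\<lambda>\<alpha>. inv (g \<alpha>)) v = P g v"
proof (rule cinner_ext)
  fix u
  have "cinner (P (\<lambda>\<alpha>. inv (g \<alpha>)) v) u = cnj (cinner u (P (\<lambda>\<alpha>. inv (g \<alpha>)) v))"
    by (rule cinner_commute)
  also have "\<dots> = cnj (cinner (P g u) v)" by (simp add: limit_adjoint[OF g])
  also have "\<dots> = cinner (P g v) u" by (simp add: sa flip: cinner_commute)
  finally show "cinner (P (\<lambda>\<alpha>. inv (g \<alpha>)) v) u = cinner (P g v) u" .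
qed

text \<open>A map that fixes \<open>v\<close> can only be cancelled where it acts first. The left factor is brought there
  by inverting the product, which does not change its self-adjoint limit.\<close>

lemma limit_mult_fixed_left:
  assumes h: "h \<in> E" and k: "k \<in> L" and hk: "(\<lambda>\<beta>. h \<beta> \<otimes> k \<beta>) \<in> E" and fixed: "P h v = v"
  shows "P (\<lambda>\<beta>. h \<beta> \<otimes> k \<beta>) v = P k v"
proof -
  note hF = in_F(2)[OF h] and kF = in_F(1)[OF k] and hkF = in_F(2)[OF hk]
  have "P (\<lambda>\<beta>. h \<beta> \<otimes> k \<beta>) v = P (\<lambda>\<beta>. inv (h \<beta> \<otimes> k \<beta>)) v"
    by (rule limit_inverse_eq[OF hkF E_selfadjoint[OF hk], symmetric])
  also have "(\<lambda>\<beta>. inv (h \<beta> \<otimes> k \<beta>)) = (\<lambda>\<beta>. inv (k \<beta>) \<otimes> inv (h \<beta>))"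
    by (simp add: group.inv_mult_group[OF group_A] K_closed F_values hF kF)
  also have "P \<dots> v = P (\<lambda>\<beta>. inv (k \<beta>)) v"
    by (rule limit_mult_fixed[OF F_inv[OF kF] F_inv[OF hF] limit_inv_fixed[OF hF fixed]])
  also have "\<dots> = P k v" by (rule limit_inverse_eq[OF kF L_selfadjoint[OF k]])
  finally show ?thesis .
qed

text \<open>Here the conjugate of \<open>h\<close> by \<open>g \<alpha>\<close> need not lie in \<open>L\<close>, but it differs from \<open>h\<close> by a member \<open>k\<close>
  of \<open>L\<close>. On \<open>w = P h v\<close>, where \<open>h\<close> acts trivially, its limit is \<open>P k w\<close>. By \<open>L_E_commute\<close> the
  vector \<open>w\<close> inherits the dichotomy from \<open>v\<close>.\<close>

lemma E_commute:
  assumes h: "h \<in> E" and g: "g \<in> E"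
  shows "P h (P g x) = P g (P h x)"
proof (rule commute_if_range_invariant)
  note gF = in_F(2)[OF g] and hF = in_F(2)[OF h]
  fix v assume v: "homogeneous v"
  define w where "w = P h v"
  have w: "P h w = w" unfolding w_def by (rule E_idem[OF h])
  have w_hom: "P k w = w \<or> P k w = 0" if "k \<in> L" for k
    using v that limit_zero[OF hF] unfolding w_def L_E_commute[OF that h] homogeneous_def
    by metis
  have "P h (\<pi> (g \<alpha>) w) = \<pi> (g \<alpha>) w \<or> P h (\<pi> (g \<alpha>) w) = 0" for \<alpha>
  proof -
    note c = F_values[OF gF, of \<alpha>]
    note conj = E_conj[OF h c]
    obtain k where k: "k \<in> L" "(\<lambda>\<beta>. inv (g \<alpha>) \<otimes> h \<beta> \<otimes> g \<alpha>) = (\<lambda>\<beta>. h \<beta> \<otimes> k \<beta>)"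
      using commutator[OF g h, of \<alpha>] by auto
    have "P h (\<pi> (g \<alpha>) w) = \<pi> (g \<alpha>) (P (\<lambda>\<beta>. h \<beta> \<otimes> k \<beta>) w)"
      using limit_conj[OF hF c in_F(2)[OF conj], of w] unfolding k(2) .
    also have "\<dots> = \<pi> (g \<alpha>) (P k w)"
      by (simp add: limit_mult_fixed_left[OF h k(1) conj[unfolded k(2)] w])
    finally show ?thesis using w_hom[OF k(1)] action_zero[OF c] by metis
  qed
  from limit_in_range[OF g hF E_selfadjoint[OF h] w this]
  show "P h (P g (P h v)) = P g (P h v)" unfolding w_def .
qed (simp_all add: E_selfadjoint[OF h] E_selfadjoint[OF g])

end

section \<open>The descending series of an FVIP group\<close>

lemma finite_length_trivial_level:
  assumes "prefiltration A G" "finite_length A G"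
  obtains d where "G (Suc d) = {\<one>\<^bsub>A\<^esub>}"
proof (cases "G 0 = {\<one>\<^bsub>A\<^esub>}")
  case True
  then have "G (Suc 0) = {\<one>\<^bsub>A\<^esub>}"
    using prefiltrationD(3)[OF assms(1), of 0] subgroup.one_closed[OF prefiltrationD(2)[OF assms(1)]]
    by blast
  then show ?thesis by (rule that)
next
  case False
  then show ?thesis using assms(2) that unfolding finite_length_def by auto
qed

lemma VIP_simps:
  "carrier (VIP A G) = {g. polynomial_map A G g \<and> g {||} = \<one>\<^bsub>A\<^esub>}"
  "g \<otimes>\<^bsub>VIP A G\<^esub> h = (\<lambda>\<alpha>. g \<alpha> \<otimes>\<^bsub>A\<^esub> h \<alpha>)" "\<one>\<^bsub>VIP A G\<^esub> = (\<lambda>_. \<one>\<^bsub>A\<^esub>)"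
  by (simp_all add: VIP_def product_group_def restrict_def)

locale fvip =
  fixes A :: "('g, 'm) monoid_scheme" (structure) and G :: "nat \<Rightarrow> 'g set"
    and F :: "(nat fset \<Rightarrow> 'g) set" and d :: nat
  assumes pre: "prefiltration A G" and trivial_level: "G (Suc d) = {\<one>}"
    and fvip: "FVIP_group A G F"
begin

sublocale A: group A
  using prefiltrationD(1)[OF pre] .

lemma subgroup_F: "subgroup F (VIP A G)" and vip: "VIP_group A G F"
  using fvip unfolding FVIP_group_def VIP_group_def by blast+

text \<open>The values lie in \<open>G 1\<close>, because \<open>g \<alpha>\<close> is the derivative of \<open>g\<close> in direction \<open>\<alpha>\<close> at the empty
  set.\<close>

lemma VIP_values:
  assumes "g \<in> carrier (VIP A G)"
  shows "truncated_polynomial A G r 0 g" "g {||} = \<one>" "g \<alpha> \<in> G 0" "g \<alpha> \<in> G (Suc 0)"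
proof -
  show tp: "truncated_polynomial A G r 0 g" for r
    using assms polynomial_map_imp_truncated[OF pre, of G g 0] by (simp add: VIP_simps)
  show one: "g {||} = \<one>" using assms by (simp add: VIP_simps)
  show "g \<alpha> \<in> G 0" using truncated_polynomial_values[OF pre tp] .
  obtain D where D: "truncated_polynomial A G 0 (Suc 0) D"
    and eq: "\<And>\<beta>. \<alpha> |\<inter>| \<beta> = {||} \<Longrightarrow> D \<beta> = inv (g \<beta>) \<otimes> g (\<alpha> |\<union>| \<beta>)"
    using truncated_polynomial_SucE[OF pre tp[of "Suc 0"], of \<alpha>] by blast
  have "D {||} = g \<alpha>"
    using eq[of "{||}"] G_carrier[OF pre truncated_polynomial_values[OF pre tp]] by (simp add: one)
  then show "g \<alpha> \<in> G (Suc 0)" using D by (metis truncated_polynomial.simps(1))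
qed

lemma F_VIP: "g \<in> F \<Longrightarrow> g \<in> carrier (VIP A G)"
  using subgroup.mem_carrier[OF subgroup_F] .

lemmas F_values = VIP_values[OF F_VIP]

lemma F_carrier: "g \<in> F \<Longrightarrow> g \<alpha> \<in> carrier A"
  using G_carrier[OF pre F_values(3)] .

text \<open>The inverse in \<open>VIP A G\<close> is by definition sought among the polynomial maps; that it is the
  pointwise inverse rests on the closure of polynomial maps under inversion.\<close>

lemma VIP_inv:
  assumes g: "g \<in> carrier (VIP A G)"
  shows "inv\<^bsub>VIP A G\<^esub> g = (\<lambda>\<alpha>. inv (g \<alpha>))"
proof -
  have carr: "h \<alpha> \<in> carrier A" if "h \<in> carrier (VIP A G)" for h \<alpha>
    using G_carrier[OF pre VIP_values(3)[OF that]] .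
  have "truncated_polynomial A G (Suc d) 0 (\<lambda>\<alpha>. inv (g \<alpha>))"
    by (rule truncated_polynomial_group(2)[OF pre VIP_values(1)[OF g]])
  then have "polynomial_map A G (\<lambda>\<alpha>. inv (g \<alpha>))"
    using truncated_imp_polynomial_map[OF pre trivial_level, of "Suc d" 0] by simp
  then have "(\<lambda>\<alpha>. inv (g \<alpha>)) \<in> carrier (VIP A G)"
    using VIP_values(2)[OF g] by (simp add: VIP_simps(1))
  then show ?thesis
    unfolding m_inv_def[of "VIP A G"]
    by (intro the_equality)
      (auto simp: VIP_simps(2,3) carr[OF g] carr fun_eq_iff intro: A.inv_equality[symmetric])
qed

lemma F_one: "(\<lambda>_. \<one>) \<in> F"
  using subgroup.one_closed[OF subgroup_F] by (simp add: VIP_simps)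

lemma F_mult: "g \<in> F \<Longrightarrow> h \<in> F \<Longrightarrow> (\<lambda>\<alpha>. g \<alpha> \<otimes> h \<alpha>) \<in> F"
  using subgroup.m_closed[OF subgroup_F] by (simp add: VIP_simps)

lemma F_inv: "g \<in> F \<Longrightarrow> (\<lambda>\<alpha>. inv (g \<alpha>)) \<in> F"
  using subgroup.m_inv_closed[OF subgroup_F] VIP_inv[OF F_VIP] by simp

lemma F_conj: "g \<in> F \<Longrightarrow> c \<in> G 0 \<Longrightarrow> (\<lambda>\<alpha>. inv c \<otimes> g \<alpha> \<otimes> c) \<in> F"
  using vip unfolding VIP_group_def by blast

lemma F_symmetric_derivative:
  assumes "g \<in> F" "\<alpha> \<noteq> {||}"
  obtains h where "h \<in> F"
    and "\<And>\<beta>. \<beta> |\<inter>| \<alpha> = {||} \<Longrightarrow> h \<beta> = inv (g \<beta>) \<otimes> g (\<alpha> |\<union>| \<beta>) \<otimes> inv (g \<alpha>)"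
  using vip assms unfolding VIP_group_def by blast

definition \<Gamma> :: "(nat fset \<Rightarrow> 'g) monoid"
  where "\<Gamma> = (VIP A G)\<lparr>carrier := F\<rparr>"

lemma \<Gamma>_simps: "carrier \<Gamma> = F" "g \<otimes>\<^bsub>\<Gamma>\<^esub> h = (\<lambda>\<alpha>. g \<alpha> \<otimes> h \<alpha>)" "\<one>\<^bsub>\<Gamma>\<^esub> = (\<lambda>_. \<one>)"
  by (simp_all add: \<Gamma>_def VIP_simps)

lemma group_\<Gamma>: "group \<Gamma>"
proof (rule groupI)
  show "\<exists>h\<in>carrier \<Gamma>. h \<otimes>\<^bsub>\<Gamma>\<^esub> g = \<one>\<^bsub>\<Gamma>\<^esub>" if "g \<in> carrier \<Gamma>" for g
    using that by (intro bexI[of _ "\<lambda>\<alpha>. inv (g \<alpha>)"]) (simp_all add: \<Gamma>_simps F_inv F_carrier)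
qed (simp_all add: \<Gamma>_simps F_one F_mult F_carrier A.m_assoc)

lemma \<Gamma>_inv:
  assumes "g \<in> F"
  shows "inv\<^bsub>\<Gamma>\<^esub> g = (\<lambda>\<alpha>. inv (g \<alpha>))"
  by (rule group.inv_equality[OF group_\<Gamma>]) (simp_all add: \<Gamma>_simps assms F_inv F_carrier)

text \<open>Since members of \<open>F\<close> take values in \<open>G 1\<close>, commutators of maps with values in \<open>G (i + 1)\<close> take
  values in \<open>G (i + 2)\<close>; so \<open>F\<close> is nilpotent.\<close>

lemma F_subgroups_finitely_generated: "group.subgroups_finitely_generated \<Gamma> F"
proof -
  obtain S where S: "finite S" "S \<subseteq> F" "F = generate (VIP A G) S"
    using fvip unfolding FVIP_group_def by blast
  have "g \<in> generate \<Gamma> S" if "g \<in> generate (VIP A G) S" for g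
    using that
  proof induction
    case one
    then show ?case using generate.one[of \<Gamma> S] by (simp add: VIP_simps \<Gamma>_simps)
  next
    case (incl g)
    then show ?case by (rule generate.incl)
  next
    case (inv g)
    then have "g \<in> F" using S(2) by blast
    then show ?case using generate.inv[OF inv, of \<Gamma>] by (simp add: VIP_inv[OF F_VIP] \<Gamma>_inv)
  next
    case (eng g h)
    then show ?case using generate.eng[OF eng(3,4)] by (simp add: VIP_simps \<Gamma>_simps)
  qed
  moreover have "generate \<Gamma> S \<subseteq> F"
    using group.generate_incl[OF group_\<Gamma>, of S] S(2) by (simp add: \<Gamma>_simps)
  ultimately have gen: "carrier \<Gamma> = generate \<Gamma> S"
    unfolding \<Gamma>_simps using equalityD1[OF S(3)] by blast
  define Z where "Z i = {g \<in> F. \<forall>\<alpha>. g \<alpha> \<in> G (Suc i)}" for i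
  have "group.subgroups_finitely_generated \<Gamma> (carrier \<Gamma>)"
  proof (rule group.nilpotent_subgroups_finitely_generated[OF group_\<Gamma> S(1) _ gen])
    show "S \<subseteq> carrier \<Gamma>" using S(2) by (simp add: \<Gamma>_simps)
    show "carrier \<Gamma> \<subseteq> Z 0" using F_values(4) by (auto simp: Z_def \<Gamma>_simps)
    show "Z d \<subseteq> {\<one>\<^bsub>\<Gamma>\<^esub>}" using trivial_level by (auto simp: Z_def \<Gamma>_simps)
    fix i g h assume g: "g \<in> Z i" "g \<in> carrier \<Gamma>" and h: "h \<in> carrier \<Gamma>"
    have "comm \<Gamma> g h = (\<lambda>\<alpha>. comm A (g \<alpha>) (h \<alpha>))"
      using g h by (simp add: comm_def \<Gamma>_simps \<Gamma>_inv)
    moreover have "comm A (g \<alpha>) (h \<alpha>) \<in> G (Suc (Suc i))" for \<alpha>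
      using prefiltration_comm[OF pre _ F_values(4), of "g \<alpha>" "Suc i" h \<alpha>] g h
      by (auto simp: Z_def \<Gamma>_simps)
    moreover have "comm \<Gamma> g h \<in> F"
      using group.comm_closed[OF group_\<Gamma> g(2) h] by (simp add: \<Gamma>_simps)
    ultimately show "comm \<Gamma> g h \<in> Z (Suc i)" by (simp add: Z_def)
  qed
  then show ?thesis by (simp add: \<Gamma>_simps)
qed

lemma F_maximal:
  assumes "\<A> \<noteq> {}"
    and H: "\<And>H. H \<in> \<A> \<Longrightarrow> H \<subseteq> F \<and> (\<lambda>_. \<one>) \<in> H \<and>
        (\<forall>k\<in>H. \<forall>l\<in>H. (\<lambda>\<alpha>. k \<alpha> \<otimes> l \<alpha>) \<in> H) \<and> (\<forall>k\<in>H. (\<lambda>\<alpha>. inv (k \<alpha>)) \<in> H)"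
  shows "\<exists>M\<in>\<A>. \<forall>H\<in>\<A>. M \<subseteq> H \<longrightarrow> H = M"
proof (rule group.subgroups_maximal_element[OF group_\<Gamma> _ assms(1)])
  show "group.subgroups_finitely_generated \<Gamma> (carrier \<Gamma>)"
    using F_subgroups_finitely_generated by (simp add: \<Gamma>_simps)
  fix H assume "H \<in> \<A>"
  note H = H[OF this]
  then have "inv\<^bsub>\<Gamma>\<^esub> k \<in> H" if "k \<in> H" for k using \<Gamma>_inv[of k] that by auto
  with H show "subgroup H \<Gamma>"
    by (intro subgroup.intro) (auto simp: \<Gamma>_simps)
qed

text \<open>The intersection of \<open>F\<close> with the polynomials for the \<open>i\<close> times shifted prefiltration need not
  contain enough maps: the symmetric derivative of one of its members agrees with a member of \<open>F\<close> only on sets disjoint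
  from \<open>\<alpha>\<close>, and on the other sets this member need not be polynomial of the lower degree.
  Therefore agreement is required only off some finite set, which is all that limits see. Each step
  uses up one of the \<open>d + 1\<close> derivatives.\<close>

definition level :: "nat \<Rightarrow> (nat fset \<Rightarrow> 'g) set"
  where "level i = {g \<in> F. \<exists>\<alpha>\<^sub>0 p. truncated_polynomial A G (Suc d - i) i p \<and> p {||} = \<one> \<and>
    (\<forall>\<beta>. \<beta> |\<inter>| \<alpha>\<^sub>0 = {||} \<longrightarrow> g \<beta> = p \<beta>)}"

lemma levelI:
  assumes "g \<in> F" "truncated_polynomial A G (Suc d - i) i p" "p {||} = \<one>"
    "\<And>\<beta>. \<beta> |\<inter>| \<alpha>\<^sub>0 = {||} \<Longrightarrow> g \<beta> = p \<beta>"
  shows "g \<in> level i"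
  using assms unfolding level_def by blast

lemma levelE:
  assumes "g \<in> level i"
  obtains \<alpha>\<^sub>0 p where "g \<in> F" "truncated_polynomial A G (Suc d - i) i p" "p {||} = \<one>"
    "\<And>\<beta>. \<beta> |\<inter>| \<alpha>\<^sub>0 = {||} \<Longrightarrow> g \<beta> = p \<beta>"
  using assms unfolding level_def by blast

lemma level_0: "level 0 = F"
proof
  have "g \<in> level 0" if "g \<in> F" for g
    by (rule levelI[where p = g and \<alpha>\<^sub>0 = "{||}"])
      (simp_all add: that F_values(1,2) del: truncated_polynomial.simps)
  then show "F \<subseteq> level 0" by blast
qed (auto simp: level_def)

lemma level_F: "level i \<subseteq> F"
  by (auto simp: level_def)

lemma level_one: "(\<lambda>_. \<one>) \<in> level i"
  by (rule levelI[OF F_one truncated_polynomial_const[OF pre]])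
    (simp_all add: subgroup.one_closed[OF prefiltrationD(2)[OF pre]])

lemma level_mult:
  assumes "g \<in> level i" "h \<in> level i"
  shows "(\<lambda>\<alpha>. g \<alpha> \<otimes> h \<alpha>) \<in> level i"
proof -
  obtain \<alpha> p where g: "g \<in> F" and p: "truncated_polynomial A G (Suc d - i) i p" "p {||} = \<one>"
    and gp: "\<And>\<beta>. \<beta> |\<inter>| \<alpha> = {||} \<Longrightarrow> g \<beta> = p \<beta>"
    using assms(1) by (rule levelE) blast
  obtain \<alpha>' q where h: "h \<in> F" and q: "truncated_polynomial A G (Suc d - i) i q" "q {||} = \<one>"
    and hq: "\<And>\<beta>. \<beta> |\<inter>| \<alpha>' = {||} \<Longrightarrow> h \<beta> = q \<beta>"
    using assms(2) by (rule levelE) blast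
  show ?thesis
    by (rule levelI[OF F_mult[OF g h] truncated_polynomial_group(1)[OF pre p(1) q(1)],
          where \<alpha>\<^sub>0 = "\<alpha> |\<union>| \<alpha>'"])
      (use gp hq in \<open>auto simp: p(2) q(2) inf_sup_distrib1\<close>)
qed

lemma level_inv:
  assumes "g \<in> level i"
  shows "(\<lambda>\<alpha>. inv (g \<alpha>)) \<in> level i"
proof -
  obtain \<alpha> p where g: "g \<in> F" and p: "truncated_polynomial A G (Suc d - i) i p" "p {||} = \<one>"
    and gp: "\<And>\<beta>. \<beta> |\<inter>| \<alpha> = {||} \<Longrightarrow> g \<beta> = p \<beta>"
    using assms by (rule levelE) blast
  show ?thesis
    by (rule levelI[OF F_inv[OF g] truncated_polynomial_group(2)[OF pre p(1)], where \<alpha>\<^sub>0 = \<alpha>])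
      (use gp in \<open>auto simp: p(2)\<close>)
qed

lemma level_conj:
  assumes "g \<in> level i" and c: "c \<in> G 0"
  shows "(\<lambda>\<alpha>. inv c \<otimes> g \<alpha> \<otimes> c) \<in> level i"
proof -
  obtain \<alpha> p where g: "g \<in> F" and p: "truncated_polynomial A G (Suc d - i) i p" "p {||} = \<one>"
    and gp: "\<And>\<beta>. \<beta> |\<inter>| \<alpha> = {||} \<Longrightarrow> g \<beta> = p \<beta>"
    using assms(1) by (rule levelE) blast
  show ?thesis
    by (rule levelI[OF F_conj[OF g c] truncated_polynomial_conj[OF pre p(1) c], where \<alpha>\<^sub>0 = \<alpha>])
      (use gp G_carrier[OF pre c] in \<open>auto simp: p(2)\<close>)
qed

text \<open>On sets that avoid the exceptional set of \<open>g\<close> as well as \<open>\<alpha>\<close>, the symmetric derivative of \<open>g\<close> is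
  the derivative \<open>D\<close> of the polynomial \<open>p\<close>, corrected by the constant that makes it trivial at the
  empty set. Conjugation by \<open>g \<alpha>\<close> puts it into the required position.\<close>

lemma level_derivative:
  assumes "i \<le> d" "g \<in> level i"
  shows "\<forall>\<^sub>F \<alpha> in IP_filter. \<exists>k\<in>level (Suc i).
    \<forall>\<beta>. \<beta> |\<inter>| \<alpha> = {||} \<longrightarrow> g (\<alpha> |\<union>| \<beta>) = g \<beta> \<otimes> g \<alpha> \<otimes> k \<beta>"
proof -
  obtain \<alpha>\<^sub>0 p where g: "g \<in> F" and p: "truncated_polynomial A G (Suc d - i) i p" and p_one: "p {||} = \<one>"
    and gp: "\<And>\<beta>. \<beta> |\<inter>| \<alpha>\<^sub>0 = {||} \<Longrightarrow> g \<beta> = p \<beta>"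
    using assms(2) by (rule levelE) blast
  have p': "truncated_polynomial A G (Suc (d - i)) i p" using p assms(1) by (simp add: Suc_diff_le)
  have p_carrier: "p \<beta> \<in> carrier A" for \<beta>
    using G_carrier[OF pre truncated_polynomial_values[OF pre p]] .
  note carr = F_carrier[OF g]
  show ?thesis
    using eventually_IP_disjoint[of \<alpha>\<^sub>0] eventually_IP_nonempty
  proof eventually_elim
    case (elim \<alpha>)
    obtain D where D: "truncated_polynomial A G (d - i) (Suc i) D"
      and D_eq: "\<And>\<beta>. \<alpha> |\<inter>| \<beta> = {||} \<Longrightarrow> D \<beta> = inv (p \<beta>) \<otimes> p (\<alpha> |\<union>| \<beta>)"
      using truncated_polynomial_SucE[OF pre p', of \<alpha>] by blast
    obtain h where h: "h \<in> F"
      and h_eq: "\<And>\<beta>. \<beta> |\<inter>| \<alpha> = {||} \<Longrightarrow> h \<beta> = inv (g \<beta>) \<otimes> g (\<alpha> |\<union>| \<beta>) \<otimes> inv (g \<alpha>)"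
      using F_symmetric_derivative[OF g elim(2)] by blast
    have D_empty: "D {||} = p \<alpha>" using D_eq[of "{||}"] p_carrier by (simp add: p_one)
    have "D {||} \<in> G (Suc i)" using truncated_polynomial_values[OF pre D] .
    then have "inv (D {||}) \<in> G (Suc i)"
      by (rule subgroup.m_inv_closed[OF prefiltrationD(2)[OF pre]])
    from truncated_polynomial_group(1)[OF pre D truncated_polynomial_const[OF pre this]]
    have q: "truncated_polynomial A G (Suc d - Suc i) (Suc i) (\<lambda>\<beta>. D \<beta> \<otimes> inv (D {||}))" by simp
    have "h \<in> level (Suc i)"
    proof (rule levelI[OF h q, where \<alpha>\<^sub>0 = "\<alpha> |\<union>| \<alpha>\<^sub>0"])
      show "D {||} \<otimes> inv (D {||}) = \<one>" by (simp add: D_empty p_carrier)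
      fix \<beta> assume "\<beta> |\<inter>| (\<alpha> |\<union>| \<alpha>\<^sub>0) = {||}"
      then have disj: "\<beta> |\<inter>| \<alpha> = {||}" "\<beta> |\<inter>| \<alpha>\<^sub>0 = {||}" by auto
      then have "(\<alpha> |\<union>| \<beta>) |\<inter>| \<alpha>\<^sub>0 = {||}" using elim(1) by auto
      then show "h \<beta> = D \<beta> \<otimes> inv (D {||})"
        using h_eq[OF disj(1)] D_eq[of \<beta>] disj gp elim(1) by (simp add: D_empty inf_commute)
    qed
    from level_conj[OF this F_values(3)[OF g]]
    show ?case
    proof (rule bexI[rotated], intro allI impI)
      fix \<beta> assume disj: "\<beta> |\<inter>| \<alpha> = {||}"
      show "g (\<alpha> |\<union>| \<beta>) = g \<beta> \<otimes> g \<alpha> \<otimes> (inv (g \<alpha>) \<otimes> h \<beta> \<otimes> g \<alpha>)"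
        unfolding h_eq[OF disj] by (simp add: carr A.m_assoc)
    qed
  qed
qed

text \<open>The value \<open>g \<alpha>\<close> lies in \<open>G 1\<close>, so as a constant map it has degree one, and the commutator with it
  raises the shift by one.\<close>

lemma level_commutator:
  assumes "i \<le> d" "g \<in> F" "h \<in> level i"
  shows "\<exists>k\<in>level (Suc i). \<forall>\<beta>. inv (g \<alpha>) \<otimes> h \<beta> \<otimes> g \<alpha> = h \<beta> \<otimes> k \<beta>"
proof (rule bexI, rule allI)
  obtain \<alpha>\<^sub>0 p where h: "h \<in> F" and p: "truncated_polynomial A G (Suc d - i) i p" and p_one: "p {||} = \<one>"
    and hp: "\<And>\<beta>. \<beta> |\<inter>| \<alpha>\<^sub>0 = {||} \<Longrightarrow> h \<beta> = p \<beta>"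
    using assms(3) by (rule levelE) blast
  note g_carr = F_carrier[OF assms(2)] and h_carr = F_carrier[OF h]
  show "inv (g \<alpha>) \<otimes> h \<beta> \<otimes> g \<alpha> = h \<beta> \<otimes> comm A (h \<beta>) (g \<alpha>)" for \<beta>
    by (rule A.conj_eq_mult_comm[OF h_carr g_carr])
  have p': "truncated_polynomial A G (Suc (d - i)) i p" using p assms(1) by (simp add: Suc_diff_le)
  have "truncated_polynomial A G (d - i) (i + Suc 0) (\<lambda>\<beta>. comm A (p \<beta>) (g \<alpha>))"
    by (rule truncated_polynomial_group(3)[OF pre truncated_polynomial_less_levels[OF pre p']
          truncated_polynomial_const[OF pre F_values(4)[OF assms(2)]]])
  then have tp: "truncated_polynomial A G (Suc d - Suc i) (Suc i) (\<lambda>\<beta>. comm A (p \<beta>) (g \<alpha>))" by simp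
  have "(\<lambda>\<beta>. inv (h \<beta>) \<otimes> (inv (g \<alpha>) \<otimes> h \<beta> \<otimes> g \<alpha>)) \<in> F"
    by (rule F_mult[OF F_inv[OF h] F_conj[OF h F_values(3)[OF assms(2)]]])
  then have "(\<lambda>\<beta>. comm A (h \<beta>) (g \<alpha>)) \<in> F"
    by (simp add: comm_def A.m_assoc g_carr h_carr)
  then show "(\<lambda>\<beta>. comm A (h \<beta>) (g \<alpha>)) \<in> level (Suc i)"
    by (rule levelI[OF _ tp, where \<alpha>\<^sub>0 = \<alpha>\<^sub>0]) (simp_all add: hp p_one g_carr comm_def)
qed

lemma level_trivial:
  assumes "g \<in> level (Suc d)"
  shows "\<forall>\<^sub>F \<alpha> in IP_filter. g \<alpha> = \<one>"
proof -
  obtain \<alpha>\<^sub>0 p where p: "truncated_polynomial A G (Suc d - Suc d) (Suc d) p"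
    and gp: "\<And>\<beta>. \<beta> |\<inter>| \<alpha>\<^sub>0 = {||} \<Longrightarrow> g \<beta> = p \<beta>"
    using assms by (rule levelE) blast
  have "p \<beta> = \<one>" for \<beta>
    using truncated_polynomial_values[OF pre p] trivial_level by blast
  with eventually_IP_disjoint[of \<alpha>\<^sub>0] gp show ?thesis by (auto elim: eventually_mono)
qed

end

section \<open>The limits are commuting projections\<close>

lemma unitary_actionD:
  assumes "prefiltration A G" "unitary_action A (G 0) \<pi>" 
  shows "a \<in> G 0 \<Longrightarrow> b \<in> G 0 \<Longrightarrow> \<pi> (a \<otimes>\<^bsub>A\<^esub> b) x = \<pi> a (\<pi> b x)"
    and "\<pi> \<one>\<^bsub>A\<^esub> x = x"
    and "a \<in> G 0 \<Longrightarrow> clinear_op (\<pi> a)"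
    and "a \<in> G 0 \<Longrightarrow> cinner (\<pi> a x) (\<pi> a y) = cinner x y"
proof -
  interpret group_action "A\<lparr>carrier := G 0\<rparr>" UNIV \<pi>
    using assms(2) unfolding unitary_action_def by blast
  show "a \<in> G 0 \<Longrightarrow> b \<in> G 0 \<Longrightarrow> \<pi> (a \<otimes>\<^bsub>A\<^esub> b) x = \<pi> a (\<pi> b x)"
    using composition_rule[of x a b] by simp
  show "\<pi> \<one>\<^bsub>A\<^esub> x = x"
    using fun_cong[OF id_eq_one, of x] by simp
  show "a \<in> G 0 \<Longrightarrow> clinear_op (\<pi> a)" "a \<in> G 0 \<Longrightarrow> cinner (\<pi> a x) (\<pi> a y) = cinner x y"
    using assms(2) unfolding unitary_action_def unitary_op_def by blast+
qed

theorem theorem3p13: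
  fixes A :: "('g, 'm) monoid_scheme"
    and G :: "nat \<Rightarrow> 'g set"
    and F :: "(nat fset \<Rightarrow> 'g) set"
    and \<pi> :: "'g \<Rightarrow> 'h::complex_hilbert \<Rightarrow> 'h"
    and P :: "(nat fset \<Rightarrow> 'g) \<Rightarrow> 'h \<Rightarrow> 'h"
  assumes "prefiltration A G"
    and "finite_length A G"
    and "FVIP_group A G F"
    and "unitary_action A (G 0) \<pi>"
    and "\<And>g. g \<in> F \<Longrightarrow> w_IP_lim (\<lambda>\<alpha>. \<pi> (g \<alpha>)) (P g)"
  shows "(\<forall>g\<in>F. orthogonal_projection (P g)) \<and>
         (\<forall>g\<in>F. \<forall>h\<in>F. P g \<circ> P h = P h \<circ> P g)"
proof -
  obtain d where d: "G (Suc d) = {\<one>\<^bsub>A\<^esub>}"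
    by (rule finite_length_trivial_level[OF assms(1,2)])
  interpret fvip A G F d
    using assms(1,3) d by unfold_locales
  interpret unitary_IP_family A "G 0" \<pi> F P
    by (rule unitary_IP_family.intro)
      (assumption | rule prefiltrationD[OF pre] unitary_actionD[OF assms(1,4)]
        F_values(3) F_one F_mult F_inv w_IP_lim_tendsto[OF assms(5)])+
  define good where "good i \<longleftrightarrow> (\<forall>g\<in>level i. orthogonal_projection (P g)) \<and>
    (\<forall>g\<in>level i. \<forall>h\<in>level i. P g \<circ> P h = P h \<circ> P g)" for i
  have "good (Suc d - j)" for j
  proof (induction j)
    case 0
    have id: "P g v = v" if g: "g \<in> level (Suc d)" for g v
    proof (rule cinner_ext, rule tendsto_unique[OF IP_filter_neq_bot weak_limit])
      show "g \<in> F" using g level_F by blast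
      show "((\<lambda>\<alpha>. cinner (\<pi> (g \<alpha>) v) u) \<longlongrightarrow> cinner v u) IP_filter" for u
        by (rule tendsto_eventually)
          (use level_trivial[OF g] in \<open>eventually_elim, simp add: action_one\<close>)
    qed
    have "orthogonal_projection (P g)" if "g \<in> level (Suc d)" for g
      using that level_F by (intro orthogonal_projectionI) (auto simp: id)
    then show ?case unfolding good_def by (auto simp: id fun_eq_iff)
  next
    case (Suc j)
    show ?case
    proof (cases "j \<le> d")
      case False
      then show ?thesis using Suc.IH by simp
    next
      case True
      define i where "i = d - j"
      have i: "Suc d - j = Suc i" "Suc d - Suc j = i" "i \<le> d"
        unfolding i_def using True by auto
      have "good (Suc i)" using Suc.IH unfolding i(1) .
      interpret derivative_step A "G 0" \<pi> F P "level (Suc i)" "level i"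
      proof
        show "\<exists>M\<in>\<A>. \<forall>H\<in>\<A>. M \<subseteq> H \<longrightarrow> H = M"
          if "\<A> \<noteq> {}" and "\<And>H. H \<in> \<A> \<Longrightarrow> H \<subseteq> level (Suc i) \<and> (\<lambda>_. \<one>\<^bsub>A\<^esub>) \<in> H \<and>
            (\<forall>k\<in>H. \<forall>l\<in>H. (\<lambda>\<alpha>. k \<alpha> \<otimes>\<^bsub>A\<^esub> l \<alpha>) \<in> H) \<and> (\<forall>k\<in>H. (\<lambda>\<alpha>. inv\<^bsub>A\<^esub> (k \<alpha>)) \<in> H)" for \<A>
          by (rule F_maximal[OF that(1)]) (use that(2) level_F[of "Suc i"] in blast)
      qed (use \<open>good (Suc i)\<close> level_F level_one level_mult level_inv level_conj
          level_derivative[OF i(3)] level_commutator[OF i(3) subsetD[OF level_F]] in \<open>auto simp: good_def\<close>)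
      show ?thesis
        unfolding i(2) good_def using E_projection E_commute by (auto simp: fun_eq_iff)
    qed
  qed
  from this[of "Suc d"] show ?thesis unfolding good_def by (simp add: level_0)
qed

end
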